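(* There exist Turing functionals $\Phi$ and $\Psi$ such that $\lambda_\Phi=\lambda_\Psi$ and yet $\Phi(\mathsf{MLR})\neq\Psi(\mathsf{MLR})$.
   Context: $2^\omega$ is Cantor space, $2^{<\omega}$ the set of finite binary strings, $\preceq$ the prefix order; $\lambda$ is the uniform measure. A Turing functional $\Phi$ is a c.e. set of pairs $(\sigma,\tau)$ of strings such that whenever $(\sigma,\tau),(\sigma',\tau')\in\Phi$ and $\sigma\preceq\sigma'$, $\tau,\tau'$ are comparable. For $X\in2^\omega$, $\Phi^X$ is the maximal finite or infinite sequence extending every $\tau$ with $(\sigma,\tau)\in\Phi$ for some $\sigma\preceq X$; $\mathrm{dom}(\Phi)=\{X:\Phi^X\text{ infinite}\}$ and $\Phi(X)=\Phi^X$ for $X\in\mathrm{dom}(\Phi)$; for $A\subseteq2^\omega$, $\Phi(A)=\{\Phi(X):X\in A\cap\mathrm{dom}(\Phi)\}$. The induced semi-measure is $\lambda_\Phi(\sigma)=\lambda(\{X:\Phi^X\succeq\sigma\})$ for $\sigma\in2^{<\omega}$. $\mathsf{MLR}$ is the set of Martin-Löf random sequences for $\lambda$. *)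

theory Defs
  imports "HOL-Probability.Probability" "HOL-Library.Nat_Bijection"
begin

datatype recf = RZero | RSucc | RProj nat | RComp recf "recf list"
  | RPrim recf recf | RMu recf

inductive reval :: "recf \<Rightarrow> nat list \<Rightarrow> nat \<Rightarrow> bool" where
  zero: "reval RZero xs 0"
| succ: "reval RSucc (x # xs) (Suc x)"
| proj: "i < length xs \<Longrightarrow> reval (RProj i) xs (xs ! i)"
| comp: "list_all2 (\<lambda>g y. reval g xs y) gs ys \<Longrightarrow> reval f ys z \<Longrightarrow> reval (RComp f gs) xs z"
| prim0: "reval f xs y \<Longrightarrow> reval (RPrim f g) (0 # xs) y"
| primS: "reval (RPrim f g) (n # xs) y \<Longrightarrow> reval g (y # n # xs) z
           \<Longrightarrow> reval (RPrim f g) (Suc n # xs) z"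
| mu: "reval f (n # xs) 0 \<Longrightarrow> (\<forall>m<n. \<exists>y. y > 0 \<and> reval f (m # xs) y)
           \<Longrightarrow> reval (RMu f) xs n"

definition ce :: "nat set \<Rightarrow> bool" where
  "ce A \<longleftrightarrow> (\<exists>f. A = {x. \<exists>y. reval f [x] y})"

type_synonym bstr = "bool list"
type_synonym cantor = "nat \<Rightarrow> bool"

text \<open>Standard computable bijection between binary strings and naturals (bijective base 2).\<close>
fun str_code :: "bstr \<Rightarrow> nat" where
  "str_code [] = 0"
| "str_code (b # xs) = 2 * str_code xs + (if b then 2 else 1)"

definition ce_strpairs :: "(bstr \<times> bstr) set \<Rightarrow> bool" where
  "ce_strpairs S \<longleftrightarrow> ce ((\<lambda>(\<sigma>, \<tau>). prod_encode (str_code \<sigma>, str_code \<tau>)) ` S)"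

definition uniformly_ce :: "(nat \<Rightarrow> bstr set) \<Rightarrow> bool" where
  "uniformly_ce U \<longleftrightarrow> ce {prod_encode (n, str_code \<sigma>) | n \<sigma>. \<sigma> \<in> U n}"

definition comparable :: "bstr \<Rightarrow> bstr \<Rightarrow> bool" where
  "comparable \<sigma> \<tau> \<longleftrightarrow> prefix \<sigma> \<tau> \<or> prefix \<tau> \<sigma>"

definition prefix_of :: "bstr \<Rightarrow> cantor \<Rightarrow> bool" where
  "prefix_of \<sigma> X \<longleftrightarrow> (\<forall>i < length \<sigma>. \<sigma> ! i = X i)"

definition lam :: "cantor measure" where
  "lam = PiM UNIV (\<lambda>_. measure_pmf (bernoulli_pmf (1/2)))"

definition cyl :: "bstr set \<Rightarrow> cantor set" where
  "cyl U = {X. \<exists>\<sigma>\<in>U. prefix_of \<sigma> X}"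

definition mltest :: "(nat \<Rightarrow> bstr set) \<Rightarrow> bool" where
  "mltest U \<longleftrightarrow> uniformly_ce U \<and> (\<forall>n. emeasure lam (cyl (U n)) \<le> ennreal ((1/2) ^ n))"

definition MLR :: "cantor set" where
  "MLR = {X. \<forall>U. mltest U \<longrightarrow> \<not> (\<forall>n. X \<in> cyl (U n))}"

definition turing_functional :: "(bstr \<times> bstr) set \<Rightarrow> bool" where
  "turing_functional \<Phi> \<longleftrightarrow> ce_strpairs \<Phi> \<and>
     (\<forall>\<sigma> \<tau> \<sigma>' \<tau>'. (\<sigma>, \<tau>) \<in> \<Phi> \<longrightarrow> (\<sigma>', \<tau>') \<in> \<Phi> \<longrightarrow> prefix \<sigma> \<sigma>' \<longrightarrow> comparable \<tau> \<tau>')"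

text \<open>\<open>tf_out \<Phi> X\<close> is the (finite or infinite) sequence \<open>\<Phi>^X\<close>, represented as a partial
  sequence: position n is defined with value b iff some \<open>(\<sigma>,\<tau>)\<in>\<Phi>\<close> with \<open>\<sigma>\<close> a prefix of X
  has \<open>\<tau>\<close> of length > n with \<open>\<tau>!n = b\<close> (this is the least sequence extending all such \<open>\<tau>\<close>).\<close>
definition tf_val :: "(bstr \<times> bstr) set \<Rightarrow> cantor \<Rightarrow> nat \<Rightarrow> bool \<Rightarrow> bool" where
  "tf_val \<Phi> X n b \<longleftrightarrow> (\<exists>\<sigma> \<tau>. (\<sigma>, \<tau>) \<in> \<Phi> \<and> prefix_of \<sigma> X \<and> n < length \<tau> \<and> \<tau> ! n = b)"

definition tf_out :: "(bstr \<times> bstr) set \<Rightarrow> cantor \<Rightarrow> nat \<Rightarrow> bool option" where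
  "tf_out \<Phi> X n = (if \<exists>b. tf_val \<Phi> X n b then Some (SOME b. tf_val \<Phi> X n b) else None)"

definition out_extends :: "(bstr \<times> bstr) set \<Rightarrow> cantor \<Rightarrow> bstr \<Rightarrow> bool" where
  "out_extends \<Phi> X \<sigma> \<longleftrightarrow> (\<forall>i < length \<sigma>. tf_out \<Phi> X i = Some (\<sigma> ! i))"

definition tf_dom :: "(bstr \<times> bstr) set \<Rightarrow> cantor set" where
  "tf_dom \<Phi> = {X. \<forall>n. tf_out \<Phi> X n \<noteq> None}"

definition tf_apply :: "(bstr \<times> bstr) set \<Rightarrow> cantor \<Rightarrow> cantor" where
  "tf_apply \<Phi> X = (\<lambda>n. the (tf_out \<Phi> X n))"

definition tf_image :: "(bstr \<times> bstr) set \<Rightarrow> cantor set \<Rightarrow> cantor set" where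
  "tf_image \<Phi> A = tf_apply \<Phi> ` (A \<inter> tf_dom \<Phi>)"

definition induced_sm :: "(bstr \<times> bstr) set \<Rightarrow> bstr \<Rightarrow> ennreal" where
  "induced_sm \<Phi> \<sigma> = emeasure lam {X. out_extends \<Phi> X \<sigma>}"

end

theory Submission
  imports Defs
begin

text \<open>
  All functionals used here only output zeros, so that \<open>\<Phi>\<close> amounts to a decreasing sequence of c.e. open sets
  \<open>V n = {X. \<Phi>^X extends 0^n}\<close> and \<open>\<lambda>_\<Phi>\<close> only sees their measures. Let \<open>X\<close> be the leftmost sequence outside
  one component of a universal Martin-Loef test. It is random and the limit of its computable
  lexicographically increasing stage-\<open>n\<close> approximations \<open>leftmost n\<close>, strings of length \<open>n\<close>. For \<open>\<Phi>\<close> let \<open>V n\<close>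
  consist of the sequences whose restriction to length \<open>n\<close> lies between \<open>leftmost n\<close> and the restriction of
  \<open>X\<close>; it is c.e. because \<open>X\<close> is left-c.e., and the \<open>V n\<close> shrink to the random point \<open>X\<close>. For \<open>\<Psi>\<close> shift each
  of these intervals to the left end: the measures are unchanged, but now the sets shrink to \<open>0^\<omega>\<close>, which
  is not random. Hence \<open>\<Phi>(MLR) = {0^\<omega>}\<close> while \<open>\<Psi>(MLR)\<close> is empty.
\<close>

section \<open>Total computable functions and decidable predicates\<close>

text \<open>Two successful searches of \<open>RMu\<close> agree because each rules out that the
  other stopped earlier. Determinacy lets \<open>ce_projection\<close> read a truth value off a
  computed one.\<close>

lemma reval_det: "reval f xs y \<Longrightarrow> reval f xs z \<Longrightarrow> y = z"
proof (induction arbitrary: z rule: reval.induct)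
  case (comp xs gs ys f w)
  from comp.prems obtain ys' where ys': "list_all2 (\<lambda>g y. reval g xs y) gs ys'" and z: "reval f ys' z"
    by (cases rule: reval.cases) auto
  have "ys = ys'"
    using comp.IH(1) ys' by (fastforce simp: list_all2_conv_all_nth intro!: nth_equalityI)
  then show ?case using comp.IH(2) z by blast
next
  case (primS f g n xs y w)
  from primS.prems obtain y' where "reval (RPrim f g) (n # xs) y'" "reval g (y' # n # xs) z"
    by (cases rule: reval.cases) auto
  then show ?case using primS.IH by blast
next
  case (mu f n xs)
  from mu.prems have z: "reval f (z # xs) 0" "\<forall>m<z. \<exists>y>0. reval f (m # xs) y"
    by (cases rule: reval.cases; simp)+
  have "\<not> z < n" using mu.IH(2) z(1) by fastforce
  moreover have "\<not> n < z" using mu.IH(1) z(2) by fastforce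
  ultimately show ?case by simp
next
  case (zero xs) then show ?case by (cases rule: reval.cases) auto
next
  case (succ x xs) then show ?case by (cases rule: reval.cases) auto
next
  case (proj i xs) from proj.prems show ?case by (cases rule: reval.cases) auto
next
  case (prim0 f xs y g) from prim0.prems have "reval f xs z" by (cases rule: reval.cases) auto
  then show ?case using prim0.IH by blast
qed

definition total_rec :: "nat \<Rightarrow> (nat list \<Rightarrow> nat) \<Rightarrow> bool" where
  "total_rec k F \<longleftrightarrow> (\<exists>r. \<forall>xs. length xs = k \<longrightarrow> reval r xs (F xs))"

lemma total_rec_cong:
  "total_rec k F \<Longrightarrow> (\<And>xs. length xs = k \<Longrightarrow> F xs = G xs) \<Longrightarrow> total_rec k G"
  unfolding total_rec_def by metis

lemma total_rec_proj: "i < k \<Longrightarrow> total_rec k (\<lambda>xs. xs ! i)"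
  unfolding total_rec_def using reval.proj by blast

lemma total_rec_comp:
  assumes F: "total_rec (length Gs) F" and Gs: "\<And>G. G \<in> set Gs \<Longrightarrow> total_rec k G"
  shows "total_rec k (\<lambda>xs. F (map (\<lambda>G. G xs) Gs))"
proof -
  obtain r where r: "\<And>xs. length xs = length Gs \<Longrightarrow> reval r xs (F xs)"
    using F unfolding total_rec_def by blast
  obtain R where R: "\<And>G xs. G \<in> set Gs \<Longrightarrow> length xs = k \<Longrightarrow> reval (R G) xs (G xs)"
    using Gs unfolding total_rec_def by metis
  have "reval (RComp r (map R Gs)) xs (F (map (\<lambda>G. G xs) Gs))" if "length xs = k" for xs
    by (rule reval.comp[where ys = "map (\<lambda>G. G xs) Gs"])
       (use that r R in \<open>auto simp: list_all2_conv_all_nth\<close>)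
  then show ?thesis unfolding total_rec_def by blast
qed

lemma total_rec_comp1:
  assumes "total_rec 1 (\<lambda>xs. f (xs ! 0))" "total_rec k G"
  shows "total_rec k (\<lambda>xs. f (G xs))"
  using total_rec_comp[of "[G]" "\<lambda>xs. f (xs ! 0)" k] assms by simp

lemma total_rec_comp2:
  assumes "total_rec 2 (\<lambda>xs. f (xs ! 0) (xs ! 1))" "total_rec k G" "total_rec k H"
  shows "total_rec k (\<lambda>xs. f (G xs) (H xs))"
  using total_rec_comp[of "[G, H]" "\<lambda>xs. f (xs ! 0) (xs ! 1)" k] assms
  by (auto simp: numeral_2_eq_2)

lemma total_rec_Suc:
  assumes "total_rec k G" shows "total_rec k (\<lambda>xs. Suc (G xs))"
proof (rule total_rec_comp1[OF _ assms])
  have "reval RSucc xs (Suc (xs ! 0))" if "length xs = 1" for xs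
    using that reval.succ by (cases xs) auto
  then show "total_rec 1 (\<lambda>xs. Suc (xs ! 0))" unfolding total_rec_def by blast
qed

lemma total_rec_const: "total_rec k (\<lambda>_. c)"
proof (induction c)
  case 0
  show ?case unfolding total_rec_def using reval.zero by blast
next
  case (Suc c)
  then show ?case by (rule total_rec_Suc)
qed

text \<open>\<open>RPrim\<close> recurses on the head of its argument list and hands the step
  program the previous value, then the counter, then the parameters; hence the order
  \<open>ys ! 0\<close>, \<open>ys ! 1\<close>, \<open>drop 2 ys\<close>.\<close>

lemma total_rec_prim:
  assumes A: "total_rec k A" and G: "total_rec (Suc (Suc k)) (\<lambda>ys. G (ys ! 0) (ys ! 1) (drop 2 ys))"
  shows "total_rec (Suc k) (\<lambda>zs. rec_nat (A (tl zs)) (\<lambda>n y. G y n (tl zs)) (hd zs))"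
proof -
  obtain a where a: "\<And>xs. length xs = k \<Longrightarrow> reval a xs (A xs)"
    using A unfolding total_rec_def by blast
  obtain g where g: "\<And>xs. length xs = Suc (Suc k) \<Longrightarrow> reval g xs (G (xs ! 0) (xs ! 1) (drop 2 xs))"
    using G unfolding total_rec_def by blast
  have *: "reval (RPrim a g) (n # xs) (rec_nat (A xs) (\<lambda>n y. G y n xs) n)" if "length xs = k" for n xs
  proof (induction n)
    case 0 show ?case using a that by (auto intro: reval.prim0)
  next
    case (Suc n)
    show ?case
      using g[of "rec_nat (A xs) (\<lambda>n y. G y n xs) n # n # xs"] that Suc
      by (auto intro: reval.primS)
  qed
  have "reval (RPrim a g) zs (rec_nat (A (tl zs)) (\<lambda>n y. G y n (tl zs)) (hd zs))" if "length zs = Suc k" for zs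
    using that *[of "tl zs" "hd zs"] by (cases zs) auto
  then show ?thesis unfolding total_rec_def by blast
qed

lemma total_rec_prim1:
  assumes G: "total_rec 2 (\<lambda>ys. G (ys ! 0) (ys ! 1))"
  shows "total_rec 1 (\<lambda>zs. rec_nat a (\<lambda>n y. G y n) (zs ! 0))"
proof -
  have "total_rec (Suc 0) (\<lambda>zs. rec_nat a (\<lambda>n y. G y n) (hd zs))"
    using total_rec_prim[of 0 "\<lambda>_. a" "\<lambda>y n _. G y n"] G total_rec_const
    by (auto simp: numeral_2_eq_2)
  then show ?thesis unfolding One_nat_def by (rule total_rec_cong) (auto simp: hd_conv_nth length_Suc_conv)
qed

lemma total_rec_prim2:
  assumes A: "total_rec 1 (\<lambda>ys. A (ys ! 0))"
    and G: "total_rec 3 (\<lambda>ys. G (ys ! 0) (ys ! 1) (ys ! 2))"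
  shows "total_rec 2 (\<lambda>zs. rec_nat (A (zs ! 1)) (\<lambda>n y. G y n (zs ! 1)) (zs ! 0))"
proof -
  have "total_rec 3 (\<lambda>ys. G (ys ! 0) (ys ! 1) (drop 2 ys ! 0))"
    by (rule total_rec_cong[OF G]) simp
  then have "total_rec (Suc 1) (\<lambda>zs. rec_nat (A (tl zs ! 0)) (\<lambda>n y. G y n (tl zs ! 0)) (hd zs))"
    using total_rec_prim[of 1 "\<lambda>ys. A (ys ! 0)" "\<lambda>y n xs. G y n (xs ! 0)"] A
    by (auto simp: numeral_3_eq_3)
  then show ?thesis
    unfolding numeral_2_eq_2 One_nat_def by (rule total_rec_cong) (auto simp: length_Suc_conv)
qed

lemma total_rec_binary:
  assumes "total_rec 1 (\<lambda>ys. A (ys ! 0))"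
    and "total_rec 3 (\<lambda>ys. G (ys ! 0) (ys ! 1) (ys ! 2))"
    and "\<And>x. f 0 x = A x" "\<And>n x. f (Suc n) x = G (f n x) n x"
    and "total_rec k H" "total_rec k K"
  shows "total_rec k (\<lambda>xs. f (H xs) (K xs))"
proof -
  have "f n x = rec_nat (A x) (\<lambda>n y. G y n x) n" for n x
    by (induction n) (auto simp: assms(3,4))
  then show ?thesis
    using total_rec_comp2[OF total_rec_prim2[OF assms(1,2)] assms(5,6)] by simp
qed

lemma total_rec_add:
  assumes "total_rec k H" "total_rec k K" shows "total_rec k (\<lambda>xs. H xs + K xs)"
  by (rule total_rec_binary[where f = "(+)" and A = "\<lambda>x. x" and G = "\<lambda>y n x. Suc y", OF _ _ _ _ assms])
     (auto intro!: total_rec_Suc total_rec_proj)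

lemma total_rec_mult:
  assumes "total_rec k H" "total_rec k K" shows "total_rec k (\<lambda>xs. H xs * K xs)"
  by (rule total_rec_binary[where f = "(*)" and A = "\<lambda>x. 0" and G = "\<lambda>y n x. x + y", OF _ _ _ _ assms])
     (auto intro!: total_rec_add total_rec_const total_rec_proj)

lemma total_rec_pred:
  assumes "total_rec k H" shows "total_rec k (\<lambda>xs. H xs - 1)"
proof (rule total_rec_comp1[OF _ assms])
  have "rec_nat 0 (\<lambda>n y. n) n = n - 1" for n :: nat by (cases n) auto
  then show "total_rec 1 (\<lambda>xs. xs ! 0 - 1)"
    using total_rec_prim1[of "\<lambda>y n. n" 0] total_rec_proj[of 1 2] by simp
qed

lemma total_rec_diff:
  assumes "total_rec k H" "total_rec k K" shows "total_rec k (\<lambda>xs. H xs - K xs)"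
  by (rule total_rec_binary[where f = "\<lambda>n x. x - n" and A = "\<lambda>x. x" and G = "\<lambda>y n x. y - 1", OF _ _ _ _ assms(2,1)])
     (auto intro!: total_rec_proj total_rec_pred[simplified])

lemma total_rec_triangle:
  assumes "total_rec k H" shows "total_rec k (\<lambda>xs. triangle (H xs))"
proof (rule total_rec_comp1[OF _ assms])
  have "rec_nat 0 (\<lambda>n y. y + Suc n) n = triangle n" for n :: nat by (induction n) auto
  then show "total_rec 1 (\<lambda>xs. triangle (xs ! 0))"
    using total_rec_prim1[of "\<lambda>y n. y + Suc n" 0, OF total_rec_add[OF total_rec_proj total_rec_Suc[OF total_rec_proj]]]
    by simp
qed

section \<open>Computable inverses of the pairing function\<close>

definition pfst :: "nat \<Rightarrow> nat" where "pfst z = fst (prod_decode z)"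
definition psnd :: "nat \<Rightarrow> nat" where "psnd z = snd (prod_decode z)"

lemma pfst_encode [simp]: "pfst (prod_encode (a, b)) = a"
  and psnd_encode [simp]: "psnd (prod_encode (a, b)) = b"
  and prod_encode_pfst_psnd [simp]: "prod_encode (pfst z, psnd z) = z"
  by (auto simp: pfst_def psnd_def)

lemma total_rec_prod_encode:
  assumes "total_rec k H" "total_rec k K" shows "total_rec k (\<lambda>xs. prod_encode (H xs, K xs))"
  unfolding prod_encode_def using assms by (auto intro!: total_rec_add total_rec_triangle)

lemma triangle_mono: "m \<le> n \<Longrightarrow> triangle m \<le> triangle n"
  by (induction rule: dec_induct) auto

text \<open>The largest \<open>k\<close> with \<open>triangle k \<le> z\<close> is \<open>pfst z + psnd z\<close>.\<close>
definition triangle_root :: "nat \<Rightarrow> nat" where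
  "triangle_root = rec_nat 0 (\<lambda>n y. y + (1 - (triangle (Suc y) - Suc n)))"

text \<open>With truncated subtraction the increment is 1 exactly when
  \<open>triangle (Suc y) \<le> Suc n\<close>, which keeps the argument between two consecutive
  triangular numbers. The code of \<open>(a, b)\<close> lies between those of index
  \<open>a + b\<close> and \<open>Suc (a + b)\<close>, and monotonicity identifies the
  index.\<close>

lemma triangle_root_encode: "triangle_root (prod_encode (a, b)) = a + b"
proof -
  have *: "triangle (triangle_root z) \<le> z \<and> z < triangle (Suc (triangle_root z))" for z
  proof (induction z)
    case (Suc z)
    have "triangle_root (Suc z) = triangle_root z + (1 - (triangle (Suc (triangle_root z)) - Suc z))"
      by (simp add: triangle_root_def)
    then have "triangle_root (Suc z) =
        (if triangle (Suc (triangle_root z)) \<le> Suc z then Suc (triangle_root z) else triangle_root z)"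
      by (simp del: triangle_Suc)
    with Suc show ?case by (auto split: if_splits)
  qed (simp add: triangle_root_def)
  have "triangle (a + b) \<le> prod_encode (a, b)" "prod_encode (a, b) < triangle (Suc (a + b))"
    by (auto simp: prod_encode_def)
  then show ?thesis using *[of "prod_encode (a, b)"]
      triangle_mono[of "Suc (triangle_root (prod_encode (a, b)))" "a + b"]
      triangle_mono[of "Suc (a + b)" "triangle_root (prod_encode (a, b))"]
    by linarith
qed

lemma total_rec_triangle_root:
  assumes "total_rec k H" shows "total_rec k (\<lambda>xs. triangle_root (H xs))"
  by (rule total_rec_comp1[OF _ assms], unfold triangle_root_def, rule total_rec_prim1)
     (intro total_rec_add total_rec_diff total_rec_triangle total_rec_Suc total_rec_proj total_rec_const; simp)

lemma pfst_eq: "pfst z = z - triangle (triangle_root z)"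
  and psnd_eq: "psnd z = triangle_root z - pfst z"
proof -
  have "z = prod_encode (pfst z, psnd z)" by simp
  moreover have "triangle_root z = pfst z + psnd z"
    using triangle_root_encode[of "pfst z" "psnd z"] by simp
  ultimately show "pfst z = z - triangle (triangle_root z)" "psnd z = triangle_root z - pfst z"
    by (auto simp: prod_encode_def)
qed

section \<open>Unary computable functions and decidable predicates\<close>

text \<open>One argument suffices since further ones are packed by \<open>prod_encode\<close>.
  Computability of a term then follows by applying \<open>comp_rules\<close> along its
  structure.\<close>

definition comp_fun :: "(nat \<Rightarrow> nat) \<Rightarrow> bool" where
  "comp_fun f \<longleftrightarrow> total_rec 1 (\<lambda>xs. f (xs ! 0))"

definition comp_pred :: "(nat \<Rightarrow> bool) \<Rightarrow> bool" where
  "comp_pred P \<longleftrightarrow> comp_fun (\<lambda>x. of_bool (P x))"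

named_theorems comp_rules

lemma comp_fun_id: "comp_fun (\<lambda>x. x)"
  unfolding comp_fun_def by (rule total_rec_proj) simp

lemma comp_fun_const: "comp_fun (\<lambda>x. c)"
  unfolding comp_fun_def by (rule total_rec_const)

lemma comp_fun_compose:
  assumes "comp_fun f" "comp_fun g" shows "comp_fun (\<lambda>x. f (g x))"
  using total_rec_comp1[of f 1 "\<lambda>xs. g (xs ! 0)"] assms unfolding comp_fun_def by simp

lemma comp_pred_compose:
  assumes "comp_pred P" "comp_fun g" shows "comp_pred (\<lambda>x. P (g x))"
  using comp_fun_compose[of "\<lambda>x. of_bool (P x)" g] assms unfolding comp_pred_def by simp

lemma comp_fun_Suc: "comp_fun f \<Longrightarrow> comp_fun (\<lambda>x. Suc (f x))"
  and comp_fun_add: "comp_fun f \<Longrightarrow> comp_fun g \<Longrightarrow> comp_fun (\<lambda>x. f x + g x)"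
  and comp_fun_mult: "comp_fun f \<Longrightarrow> comp_fun g \<Longrightarrow> comp_fun (\<lambda>x. f x * g x)"
  and comp_fun_diff: "comp_fun f \<Longrightarrow> comp_fun g \<Longrightarrow> comp_fun (\<lambda>x. f x - g x)"
  and comp_fun_prod_encode: "comp_fun f \<Longrightarrow> comp_fun g \<Longrightarrow> comp_fun (\<lambda>x. prod_encode (f x, g x))"
  unfolding comp_fun_def
  by (intro total_rec_Suc total_rec_add total_rec_mult total_rec_diff total_rec_prod_encode; assumption)+

lemma comp_fun_pfst: "comp_fun f \<Longrightarrow> comp_fun (\<lambda>x. pfst (f x))"
  unfolding comp_fun_def pfst_eq
  by (intro total_rec_diff total_rec_triangle total_rec_triangle_root)

lemma comp_fun_psnd: "comp_fun f \<Longrightarrow> comp_fun (\<lambda>x. psnd (f x))"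
  using comp_fun_pfst[of f] unfolding comp_fun_def psnd_eq
  by (intro total_rec_diff total_rec_triangle_root)

lemma comp_fun_rec_nat:
  assumes a: "comp_fun a" and b: "comp_fun b"
    and g: "comp_fun (\<lambda>z. g (pfst z) (pfst (psnd z)) (psnd (psnd z)))"
  shows "comp_fun (\<lambda>x. rec_nat (a x) (g x) (b x))"
proof -
  \<comment> \<open>\<open>RPrim\<close> supplies the previous value, the counter and the parameter
    in this order, whereas \<open>g\<close> expects the reverse order, so the triple is
    repacked.\<close>
  have "total_rec 3 (\<lambda>ys. (\<lambda>z. g (pfst z) (pfst (psnd z)) (psnd (psnd z)))
      (prod_encode (ys ! 2, prod_encode (ys ! 1, ys ! 0))))"
    by (rule total_rec_comp1[OF g[unfolded comp_fun_def]])
       (auto intro!: total_rec_prod_encode total_rec_proj)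
  then have "total_rec 3 (\<lambda>ys. g (ys ! 2) (ys ! 1) (ys ! 0))" by simp
  from total_rec_prim2[OF a[unfolded comp_fun_def], of "\<lambda>y n x. g x n y", OF this]
  have "total_rec 2 (\<lambda>zs. rec_nat (a (zs ! 1)) (g (zs ! 1)) (zs ! 0))" by simp
  from total_rec_comp2[of "\<lambda>n x. rec_nat (a x) (g x) n", OF this b[unfolded comp_fun_def], of "\<lambda>xs. xs ! 0"]
  show ?thesis unfolding comp_fun_def by (simp add: total_rec_proj)
qed

lemma comp_fun_sum:
  assumes b: "comp_fun b" and g: "comp_fun (\<lambda>z. g (pfst z) (psnd z))"
  shows "comp_fun (\<lambda>x. \<Sum>i<b x. g x i)"
proof -
  have "(\<Sum>i<n. g x i) = rec_nat 0 (\<lambda>i y. y + g x i) n" for x n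
    by (induction n) auto
  moreover have "comp_fun (\<lambda>z. g (pfst z) (pfst (psnd z)))"
    using comp_fun_compose[OF g, of "\<lambda>z. prod_encode (pfst z, pfst (psnd z))"]
    by (simp add: comp_fun_prod_encode comp_fun_pfst comp_fun_psnd comp_fun_id)
  then have "comp_fun (\<lambda>x. rec_nat 0 (\<lambda>i y. y + g x i) (b x))"
    by (intro comp_fun_rec_nat b comp_fun_add comp_fun_const comp_fun_psnd comp_fun_id)
  ultimately show ?thesis by simp
qed

lemma comp_fun_of_bool: "comp_pred P \<Longrightarrow> comp_fun (\<lambda>x. of_bool (P x))"
  unfolding comp_pred_def .

lemma comp_pred_not: "comp_pred P \<Longrightarrow> comp_pred (\<lambda>x. \<not> P x)"
proof -
  have "of_bool (\<not> P x) = 1 - (of_bool (P x) :: nat)" for x by simp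
  then show "comp_pred P \<Longrightarrow> comp_pred (\<lambda>x. \<not> P x)"
    unfolding comp_pred_def by (auto intro: comp_fun_diff comp_fun_const)
qed

lemma comp_pred_conj: "comp_pred P \<Longrightarrow> comp_pred Q \<Longrightarrow> comp_pred (\<lambda>x. P x \<and> Q x)"
  unfolding comp_pred_def of_bool_conj by (rule comp_fun_mult)

lemma comp_pred_disj: "comp_pred P \<Longrightarrow> comp_pred Q \<Longrightarrow> comp_pred (\<lambda>x. P x \<or> Q x)"
  using comp_pred_not[OF comp_pred_conj[OF comp_pred_not comp_pred_not], of P Q] by simp

lemma comp_pred_le: "comp_fun f \<Longrightarrow> comp_fun g \<Longrightarrow> comp_pred (\<lambda>x. f x \<le> g x)"
proof -
  have "of_bool (f x \<le> g x) = 1 - (f x - g x)" for x by simp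
  then show "comp_fun f \<Longrightarrow> comp_fun g \<Longrightarrow> comp_pred (\<lambda>x. f x \<le> g x)"
    unfolding comp_pred_def by (auto intro: comp_fun_diff comp_fun_const)
qed

lemma comp_pred_less: "comp_fun f \<Longrightarrow> comp_fun g \<Longrightarrow> comp_pred (\<lambda>x. f x < g x)"
  unfolding Suc_le_eq[symmetric] by (intro comp_pred_le comp_fun_Suc)

lemma comp_pred_eq: "comp_fun f \<Longrightarrow> comp_fun g \<Longrightarrow> comp_pred (\<lambda>x. f x = g x)"
  unfolding eq_iff by (intro comp_pred_conj comp_pred_le)

lemma comp_pred_bex:
  assumes "comp_fun b" "comp_pred (\<lambda>z. P (pfst z) (psnd z))"
  shows "comp_pred (\<lambda>x. \<exists>i<b x. P x i)"
proof -
  have "(\<exists>i<b x. P x i) = ((0::nat) < (\<Sum>i<b x. of_bool (P x i)))" for x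
    by (auto simp del: sum_of_bool_eq simp: zero_less_iff_neq_zero sum_eq_0_iff)
  then show ?thesis using assms
    by (auto intro!: comp_pred_less comp_fun_const comp_fun_sum comp_fun_of_bool simp del: sum_of_bool_eq)
qed

lemma comp_pred_ball:
  assumes "comp_fun b" "comp_pred (\<lambda>z. P (pfst z) (psnd z))"
  shows "comp_pred (\<lambda>x. \<forall>i<b x. P x i)"
  using comp_pred_not[OF comp_pred_bex[OF assms(1) comp_pred_not[OF assms(2)]]] by simp

lemma comp_fun_power2: "comp_fun f \<Longrightarrow> comp_fun (\<lambda>x. 2 ^ f x)"
proof -
  have "rec_nat 1 (\<lambda>i y. 2 * y) n = (2 :: nat) ^ n" for n by (induction n) auto
  moreover assume "comp_fun f"
  then have "comp_fun (\<lambda>x. rec_nat 1 (\<lambda>i y. 2 * y) (f x))"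
    by (intro comp_fun_rec_nat comp_fun_mult comp_fun_const comp_fun_psnd comp_fun_id)
  ultimately show ?thesis by simp
qed

text \<open>The quotient of \<open>a\<close> by \<open>b > 0\<close> is the number of
  \<open>i < a\<close> with \<open>Suc i * b \<le> a\<close>, a bounded sum over a decidable
  condition.\<close>

lemma comp_fun_div_power2: 
  assumes "comp_fun f" "comp_fun g" shows "comp_fun (\<lambda>x. f x div 2 ^ g x)"
proof -
  have "a div b = (\<Sum>i<a. of_bool (Suc i * b \<le> a))" if "b > 0" for a b :: nat
  proof -
    have "{i. i < a \<and> Suc i * b \<le> a} = {..<a div b}"
      using that less_le_trans[OF _ div_le_dividend[of a b]]
      by (simp add: less_eq_div_iff_mult_less_eq[symmetric] Suc_le_eq set_eq_iff del: mult_Suc)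
         blast
    then show ?thesis
      by (simp add: Int_def del: mult_Suc)
  qed
  then have "f x div 2 ^ g x = (\<Sum>i<f x. of_bool (Suc i * 2 ^ g x \<le> f x))" for x by simp
  moreover have "comp_fun (\<lambda>x. \<Sum>i<f x. of_bool (Suc i * 2 ^ g x \<le> f x))"
    by (intro comp_fun_sum comp_fun_of_bool comp_pred_le comp_fun_mult comp_fun_Suc comp_fun_power2
        comp_fun_compose[OF assms(1)] comp_fun_compose[OF assms(2)] comp_fun_pfst comp_fun_psnd comp_fun_id)
  ultimately show ?thesis by simp
qed

lemma comp_pred_odd: "comp_fun f \<Longrightarrow> comp_pred (\<lambda>x. odd (f x))"
proof -
  have *: "odd n \<longleftrightarrow> n - 2 * (n div 2 ^ 1) = 1" for n :: nat by simp presburger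
  assume "comp_fun f"
  then show ?thesis
    unfolding * by (intro comp_pred_eq comp_fun_diff comp_fun_mult comp_fun_div_power2 comp_fun_const)
qed

lemmas [comp_rules] = comp_fun_id comp_fun_const comp_fun_Suc comp_fun_add comp_fun_mult comp_fun_diff
  comp_fun_prod_encode comp_fun_pfst comp_fun_psnd comp_fun_sum comp_fun_of_bool comp_pred_not
  comp_pred_conj comp_pred_disj comp_pred_le comp_pred_less comp_pred_eq comp_pred_bex comp_pred_ball
  comp_fun_power2 comp_fun_div_power2 comp_pred_odd

text \<open>Search with \<open>RMu\<close> for the least \<open>s\<close>. The search halts iff a
  witness exists, since the program tested at each \<open>s\<close> is total.\<close>

lemma ce_projection:
  assumes "comp_pred P" shows "ce {x. \<exists>s. P (prod_encode (x, s))}"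
proof -
  \<comment> \<open>\<open>RMu\<close> stops at value 0, so the negated predicate is tested; it puts
    the search variable in front, so \<open>zs ! 0\<close> is \<open>s\<close> and
    \<open>zs ! 1\<close> is \<open>x\<close>.\<close>
  have "total_rec 2 (\<lambda>zs. (\<lambda>z. of_bool (\<not> P z)) (prod_encode (zs ! 1, zs ! 0)))"
    by (rule total_rec_comp1) (use comp_pred_not[OF assms] in
      \<open>auto simp: comp_pred_def comp_fun_def intro!: total_rec_prod_encode total_rec_proj\<close>)
  then obtain r where r': "\<And>zs. length zs = 2 \<Longrightarrow> reval r zs (of_bool (\<not> P (prod_encode (zs ! 1, zs ! 0))))"
    unfolding total_rec_def by blast
  have r: "reval r [s, x] (of_bool (\<not> P (prod_encode (x, s))))" for s x
    using r'[of "[s, x]"] by simp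
  have "(\<exists>y. reval (RMu r) [x] y) \<longleftrightarrow> (\<exists>s. P (prod_encode (x, s)))" for x
  proof
    assume "\<exists>y. reval (RMu r) [x] y"
    then obtain y where "reval (RMu r) [x] y" ..
    then have "reval r [y, x] 0" by (cases rule: reval.cases) simp
    then have "P (prod_encode (x, y))" using reval_det[OF r[of y x], of 0] by simp
    then show "\<exists>s. P (prod_encode (x, s))" ..
  next
    assume ex: "\<exists>s. P (prod_encode (x, s))"
    define n where "n = (LEAST s. P (prod_encode (x, s)))"
    have "P (prod_encode (x, n))" using ex unfolding n_def by (rule LeastI_ex)
    moreover have "\<not> P (prod_encode (x, m))" if "m < n" for m using that not_less_Least unfolding n_def by blast
    ultimately have "reval r [n, x] 0" "\<And>m. m < n \<Longrightarrow> reval r [m, x] 1"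
      using r[of _ x] by (metis of_bool_eq(1), metis of_bool_eq(2))
    then have "reval (RMu r) [x] n"
      by (intro reval.mu) (auto intro!: exI[of _ 1])
    then show "\<exists>y. reval (RMu r) [x] y" ..
  qed
  then show ?thesis unfolding ce_def by (intro exI[of _ "RMu r"]) simp
qed

section \<open>A universal enumeration of the c.e. sets\<close>

definition lcons :: "nat \<Rightarrow> nat \<Rightarrow> nat" where "lcons a l = Suc (prod_encode (a, l))"
definition lhd :: "nat \<Rightarrow> nat" where "lhd l = pfst (l - 1)"
definition ltl :: "nat \<Rightarrow> nat" where "ltl l = psnd (l - 1)"

lemma lhd_lcons [simp]: "lhd (lcons a l) = a"
  and ltl_lcons [simp]: "ltl (lcons a l) = l"
  and lcons_neq_0 [simp]: "lcons a l \<noteq> 0" "lcons a l > 0"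
  by (auto simp: lcons_def lhd_def ltl_def)

lemma list_encode_Cons: "list_encode (a # xs) = lcons a (list_encode xs)"
  by (simp add: lcons_def)

lemma lcons_lhd_ltl: "l \<noteq> 0 \<Longrightarrow> lcons (lhd l) (ltl l) = l"
  by (cases l) (auto simp: lcons_def lhd_def ltl_def)

fun recf_code :: "recf \<Rightarrow> nat" where
  "recf_code RZero = prod_encode (0, 0)"
| "recf_code RSucc = prod_encode (1, 0)"
| "recf_code (RProj i) = prod_encode (2, i)"
| "recf_code (RComp f gs) = prod_encode (3, prod_encode (recf_code f, list_encode (map recf_code gs)))"
| "recf_code (RPrim f g) = prod_encode (4, prod_encode (recf_code f, recf_code g))"
| "recf_code (RMu f) = prod_encode (5, recf_code f)"

text \<open>\<open>eval_step M k c x y\<close>: the claim ``program \<open>c\<close> maps the argument list \<open>x\<close> to \<open>y\<close>'' follows by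
  one rule of \<open>reval\<close> from the claims in \<open>M\<close>, all existential witnesses being below \<open>k\<close>.
  The auxiliary tag 6 evaluates a list of programs on the same arguments.\<close>
definition eval_step :: "(nat \<Rightarrow> nat \<Rightarrow> nat \<Rightarrow> bool) \<Rightarrow> nat \<Rightarrow> nat \<Rightarrow> nat \<Rightarrow> nat \<Rightarrow> bool" where
  "eval_step M k c x y \<longleftrightarrow>
    pfst c = 0 \<and> y = 0 \<or>
    pfst c = 1 \<and> x \<noteq> 0 \<and> y = Suc (lhd x) \<or>
    pfst c = 2 \<and> x \<noteq> 0 \<and> psnd c = 0 \<and> y = lhd x \<or>
    pfst c = 2 \<and> x \<noteq> 0 \<and> psnd c \<noteq> 0 \<and> M (prod_encode (2, psnd c - 1)) (ltl x) y \<or>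
    pfst c = 3 \<and> (\<exists>z<k. M (prod_encode (6, psnd (psnd c))) x z \<and> M (pfst (psnd c)) z y) \<or>
    pfst c = 4 \<and> x \<noteq> 0 \<and> lhd x = 0 \<and> M (pfst (psnd c)) (ltl x) y \<or>
    pfst c = 4 \<and> x \<noteq> 0 \<and> lhd x \<noteq> 0 \<and> (\<exists>z<k. M c (lcons (lhd x - 1) (ltl x)) z \<and>
       M (psnd (psnd c)) (lcons z (lcons (lhd x - 1) (ltl x))) y) \<or>
    pfst c = 5 \<and> M (psnd c) (lcons y x) 0 \<and> (\<forall>m<y. \<exists>z<k. z \<noteq> 0 \<and> M (psnd c) (lcons m x) z) \<or>
    pfst c = 6 \<and> psnd c = 0 \<and> y = 0 \<or>
    pfst c = 6 \<and> psnd c \<noteq> 0 \<and> y \<noteq> 0 \<and> M (lhd (psnd c)) x (lhd y) \<and>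
       M (prod_encode (6, ltl (psnd c))) x (ltl y)"

definition coded_rel :: "nat \<Rightarrow> nat \<Rightarrow> nat \<Rightarrow> nat \<Rightarrow> bool" where
  "coded_rel S c x y \<longleftrightarrow> odd (S div 2 ^ prod_encode (c, prod_encode (x, y)))"

text \<open>Stage \<open>k\<close> of the enumeration of all true claims, as a finite set coded in binary.\<close>
definition eval_stage :: "nat \<Rightarrow> nat" where
  "eval_stage = rec_nat 0 (\<lambda>k S. \<Sum>p<k.
     of_bool (eval_step (coded_rel S) k (pfst p) (pfst (psnd p)) (psnd (psnd p))) * 2 ^ p)"

definition evals :: "nat \<Rightarrow> nat \<Rightarrow> nat \<Rightarrow> nat \<Rightarrow> bool" where
  "evals k = coded_rel (eval_stage k)"

lemma comp_fun_lcons: "comp_fun f \<Longrightarrow> comp_fun g \<Longrightarrow> comp_fun (\<lambda>x. lcons (f x) (g x))"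
  unfolding lcons_def by (intro comp_rules)

lemma comp_fun_lhd: "comp_fun f \<Longrightarrow> comp_fun (\<lambda>x. lhd (f x))"
  unfolding lhd_def by (intro comp_rules)

lemma comp_fun_ltl: "comp_fun f \<Longrightarrow> comp_fun (\<lambda>x. ltl (f x))"
  unfolding ltl_def by (intro comp_rules)

lemmas [comp_rules] = comp_fun_lcons comp_fun_lhd comp_fun_ltl

lemma comp_fun_eval_stage: "comp_fun f \<Longrightarrow> comp_fun (\<lambda>x. eval_stage (f x))"
  unfolding eval_stage_def eval_step_def coded_rel_def
  by (intro comp_fun_rec_nat comp_rules)

lemma comp_pred_evals:
  "comp_fun k \<Longrightarrow> comp_fun c \<Longrightarrow> comp_fun a \<Longrightarrow> comp_fun y \<Longrightarrow> comp_pred (\<lambda>x. evals (k x) (c x) (a x) (y x))"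
  unfolding evals_def coded_rel_def by (intro comp_rules comp_fun_eval_stage)

lemmas [comp_rules] = comp_pred_evals

lemma evals_0: "\<not> evals 0 c x y"
  by (simp add: evals_def eval_stage_def coded_rel_def)

text \<open>The sum defining a stage runs over distinct powers of two, so it is
  \<open>set_encode\<close> of a finite set, and its binary digits return the claims just
  accepted.\<close>

lemma evals_Suc:
  "evals (Suc k) c x y \<longleftrightarrow> prod_encode (c, prod_encode (x, y)) < k \<and> eval_step (evals k) k c x y"
proof -
  let ?P = "\<lambda>p. eval_step (evals k) k (pfst p) (pfst (psnd p)) (psnd (psnd p))"
  have "eval_stage (Suc k) = (\<Sum>p<k. of_bool (?P p) * 2 ^ p)"
    by (simp add: eval_stage_def evals_def)
  also have "\<dots> = (\<Sum>p\<in>{p. p < k \<and> ?P p}. 2 ^ p)"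
    by (intro sum.mono_neutral_cong_right) auto
  also have "\<dots> = set_encode {p. p < k \<and> ?P p}"
    by (simp add: set_encode_def)
  finally have "set_decode (eval_stage (Suc k)) = {p. p < k \<and> ?P p}"
    by (simp add: set_encode_inverse)
  then show ?thesis
    unfolding evals_def[of "Suc k"] coded_rel_def by (auto simp: set_decode_def set_eq_iff)
qed

text \<open>Speaking of all large stages lets finitely many premises hold at a common stage, with
  the witnesses and the code of the claim below the stage bound.\<close>

lemma evals_eventuallyI:
  assumes "\<forall>\<^sub>F k in sequentially. eval_step (evals k) k c x y"
  shows "\<forall>\<^sub>F k in sequentially. evals k c x y"
proof -
  have "\<forall>\<^sub>F k in sequentially. evals (Suc k) c x y"
    using assms eventually_gt_at_top[of "prod_encode (c, prod_encode (x, y))"]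
    by eventually_elim (simp add: evals_Suc)
  then show ?thesis by (rule eventually_sequentially_Suc[THEN iffD1])
qed

text \<open>Each rule of \<open>reval\<close> becomes one \<open>eval_step\<close> once its premises
  have been enumerated. Two cases take several steps: projections peel off one list entry at a time,
  and compositions evaluate the argument programs one by one through tag 6.\<close>

lemma evals_complete:
  "reval f xs y \<Longrightarrow> \<forall>\<^sub>F k in sequentially. evals k (recf_code f) (list_encode xs) y"
proof (induction rule: reval.induct)
  case (zero xs)
  show ?case by (rule evals_eventuallyI) (simp add: eval_step_def)
next
  case (succ x xs)
  show ?case by (rule evals_eventuallyI) (simp add: eval_step_def list_encode_Cons del: list_encode.simps)
next
  case (proj i xs)
  then show ?case
  proof (induction i arbitrary: xs)
    case 0
    then obtain a as where "xs = a # as" by (cases xs) auto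
    then show ?case
      by (intro evals_eventuallyI) (simp add: eval_step_def list_encode_Cons del: list_encode.simps)
  next
    case (Suc i)
    then obtain a as where as: "xs = a # as" "i < length as" by (cases xs) auto
    have "\<forall>\<^sub>F k in sequentially. evals k (recf_code (RProj i)) (list_encode as) (as ! i)"
      using Suc.IH as by blast
    then show ?case
      by (intro evals_eventuallyI, elim eventually_mono)
         (simp add: as eval_step_def list_encode_Cons del: list_encode.simps)
  qed
next
  case (comp xs gs ys f w)
  have "\<forall>\<^sub>F k in sequentially. evals k (prod_encode (6, list_encode (map recf_code gs))) (list_encode xs) (list_encode ys)"
    using comp.IH(1)
  proof (induction rule: list_all2_induct)
    case Nil
    show ?case by (rule evals_eventuallyI) (simp add: eval_step_def)
  next
    case (Cons g gs y ys)
    have "\<forall>\<^sub>F k in sequentially. evals k (recf_code g) (list_encode xs) y" using Cons by blast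
    then have "\<forall>\<^sub>F k in sequentially. eval_step (evals k) k (prod_encode (6, list_encode (map recf_code (g # gs))))
        (list_encode xs) (list_encode (y # ys))"
      using Cons.IH by eventually_elim (simp add: eval_step_def list_encode_Cons del: list_encode.simps)
    then show ?case by (rule evals_eventuallyI)
  qed
  then have "\<forall>\<^sub>F k in sequentially. eval_step (evals k) k (recf_code (RComp f gs)) (list_encode xs) w"
    using comp.IH(2) eventually_gt_at_top[of "list_encode ys"]
    by eventually_elim (auto simp: eval_step_def)
  then show ?case by (rule evals_eventuallyI)
next
  case (prim0 f xs y g)
  then show ?case
    by (intro evals_eventuallyI, elim eventually_mono)
       (simp add: eval_step_def list_encode_Cons del: list_encode.simps)
next
  case (primS f g n xs y z)
  have "\<forall>\<^sub>F k in sequentially. eval_step (evals k) k (recf_code (RPrim f g)) (list_encode (Suc n # xs)) z"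
    using primS.IH eventually_gt_at_top[of y]
    by eventually_elim (auto simp: eval_step_def list_encode_Cons simp del: list_encode.simps)
  then show ?case by (rule evals_eventuallyI)
next
  case (mu f n xs)
  \<comment> \<open>A search ending at \<open>n\<close> has only finitely many earlier tests, so all
    large stages are beyond all their values and enumerations.\<close>
  from mu.IH(2) obtain z where z: "\<And>m. m < n \<Longrightarrow> z m > 0 \<and>
      (\<forall>\<^sub>F k in sequentially. evals k (recf_code f) (list_encode (m # xs)) (z m))"
    by metis
  have "\<forall>\<^sub>F k in sequentially. z m < k \<and> evals k (recf_code f) (list_encode (m # xs)) (z m)" if "m < n" for m
    using z[OF that] eventually_gt_at_top[of "z m"] by (auto intro: eventually_conj)
  then have "\<forall>\<^sub>F k in sequentially. \<forall>m\<in>{..<n}. z m < k \<and> evals k (recf_code f) (list_encode (m # xs)) (z m)"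
    by (intro eventually_ball_finite) auto
  then have "\<forall>\<^sub>F k in sequentially. eval_step (evals k) k (recf_code (RMu f)) (list_encode xs) n"
    using mu.IH(1)
  proof eventually_elim
    case (elim k)
    have "\<forall>m<n. \<exists>w<k. w \<noteq> 0 \<and> evals k (recf_code f) (lcons m (list_encode xs)) w"
      using elim(1) z by (auto simp: list_encode_Cons simp del: list_encode.simps)
    then show ?case using elim(2) by (simp add: eval_step_def list_encode_Cons del: list_encode.simps)
  qed
  then show ?case by (rule evals_eventuallyI)
qed

text \<open>Induction on the stage, with programs and lists of programs treated together because
  \<open>RComp\<close> relies on tag 6 and tag 6 on single programs.\<close>

lemma evals_sound:
  "(evals k (recf_code f) (list_encode xs) y \<longrightarrow> reval f xs y) \<and>
   (evals k (prod_encode (6, list_encode (map recf_code gs))) (list_encode xs) y \<longrightarrow>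
     (\<exists>ys. y = list_encode ys \<and> list_all2 (\<lambda>g y. reval g xs y) gs ys))"
proof (induction k arbitrary: f gs xs y)
  case 0
  show ?case by (simp add: evals_0)
next
  case (Suc k)
  have sound: "evals k (recf_code f) (list_encode xs) y \<Longrightarrow> reval f xs y" for f xs y
    using Suc by blast
  have sound': "evals k (recf_code f) (lcons a (list_encode xs)) y \<Longrightarrow> reval f (a # xs) y" for f xs y a
    using sound[of f "a # xs"] by (simp add: list_encode_Cons del: list_encode.simps)
  have sound'': "evals k (recf_code f) (lcons b (lcons a (list_encode xs))) y \<Longrightarrow> reval f (b # a # xs) y" for f xs y a b
    using sound'[of f b "a # xs"] by (simp add: list_encode_Cons del: list_encode.simps)
  have sound6: "\<exists>ys. y = list_encode ys \<and> list_all2 (\<lambda>g y. reval g xs y) gs ys"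
    if "evals k (prod_encode (6, list_encode (map recf_code gs))) (list_encode xs) y" for gs xs y
    using Suc that by blast
  have "reval f xs y" if "eval_step (evals k) k (recf_code f) (list_encode xs) y"
  proof (cases f)
    case RZero
    then show ?thesis using that by (auto simp: eval_step_def intro: reval.zero)
  next
    case RSucc
    then show ?thesis using that 
      by (cases xs) (auto simp: eval_step_def list_encode_Cons simp del: list_encode.simps(2) intro: reval.succ)
  next
    case (RProj i)
    show ?thesis
    proof (cases xs)
      case Nil
      then show ?thesis using that RProj by (simp add: eval_step_def)
    next
      case (Cons a as)
      show ?thesis
      proof (cases i)
        case 0
        then show ?thesis using that RProj Cons reval.proj[of 0 xs]
          by (auto simp: eval_step_def list_encode_Cons simp del: list_encode.simps(2))
      next
        case (Suc j)
        then have "evals k (recf_code (RProj j)) (list_encode as) y"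
          using that RProj Cons
          by (auto simp: eval_step_def list_encode_Cons simp del: list_encode.simps(2))
        then have "reval (RProj j) as y" by (rule sound)
        then have "j < length as" "y = as ! j" by (cases rule: reval.cases; simp)+
        then show ?thesis using reval.proj[of i xs] RProj Cons Suc by simp
      qed
    qed
  next
    case (RComp g gs)
    with that obtain z where z: "evals k (prod_encode (6, list_encode (map recf_code gs))) (list_encode xs) z"
        "evals k (recf_code g) z y"
      by (auto simp: eval_step_def)
    from sound6[OF z(1)] obtain ys where "z = list_encode ys" "list_all2 (\<lambda>g y. reval g xs y) gs ys" by blast
    then show ?thesis using z(2) sound RComp reval.comp by blast
  next
    case (RPrim g h)
    show ?thesis
    proof (cases xs)
      case Nil
      then show ?thesis using that RPrim by (simp add: eval_step_def)
    next
      case (Cons a as)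
      show ?thesis
      proof (cases a)
        case 0
        then have "evals k (recf_code g) (list_encode as) y" using that RPrim Cons
          by (auto simp: eval_step_def list_encode_Cons simp del: list_encode.simps(2))
        then show ?thesis using sound reval.prim0 RPrim Cons 0 by blast
      next
        case (Suc n)
        with that RPrim Cons obtain z where
            "evals k (recf_code (RPrim g h)) (lcons n (list_encode as)) z"
            "evals k (recf_code h) (lcons z (lcons n (list_encode as))) y"
          by (auto simp: eval_step_def list_encode_Cons simp del: list_encode.simps(2))
        then show ?thesis using sound' sound'' reval.primS RPrim Cons Suc by blast
      qed
    qed
  next
    case (RMu g)
    with that have "evals k (recf_code g) (lcons y (list_encode xs)) 0"
        "\<forall>m<y. \<exists>z<k. z \<noteq> 0 \<and> evals k (recf_code g) (lcons m (list_encode xs)) z"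
      by (auto simp: eval_step_def)
    then show ?thesis unfolding RMu using sound' by (intro reval.mu) (auto, metis neq0_conv)
  qed
  moreover have "\<exists>ys. y = list_encode ys \<and> list_all2 (\<lambda>g y. reval g xs y) gs ys"
    if "eval_step (evals k) k (prod_encode (6, list_encode (map recf_code gs))) (list_encode xs) y"
  proof (cases gs)
    case Nil
    then show ?thesis using that by (intro exI[of _ "[]"]) (simp add: eval_step_def)
  next
    case (Cons g gs')
    with that have "y \<noteq> 0" and hd: "evals k (recf_code g) (list_encode xs) (lhd y)"
      and tl: "evals k (prod_encode (6, list_encode (map recf_code gs'))) (list_encode xs) (ltl y)"
      by (auto simp: eval_step_def list_encode_Cons simp del: list_encode.simps(2))
    from sound6[OF tl] obtain ys where ys: "ltl y = list_encode ys" "list_all2 (\<lambda>g y. reval g xs y) gs' ys"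
      by blast
    have "y = list_encode (lhd y # ys)"
      using lcons_lhd_ltl[OF \<open>y \<noteq> 0\<close>] ys by (simp add: list_encode_Cons del: list_encode.simps)
    then show ?thesis using ys sound[OF hd] Cons by blast
  qed
  ultimately show ?case by (auto simp: evals_Suc)
qed

text \<open>\<open>lcons x 0\<close> codes the argument list \<open>[x]\<close>. Bounding both the
  stage and the value by \<open>t\<close> keeps the predicate decidable and makes it monotone in
  \<open>t\<close>.\<close>

definition enumerated :: "nat \<Rightarrow> nat \<Rightarrow> nat \<Rightarrow> bool" where
  "enumerated t e x \<longleftrightarrow> (\<exists>k<t. \<exists>y<t. evals k e (lcons x 0) y)"

lemma enumerated_mono: "enumerated s e x \<Longrightarrow> s \<le> t \<Longrightarrow> enumerated t e x"
  unfolding enumerated_def by (meson less_le_trans)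

lemma comp_pred_enumerated:
  assumes "comp_fun t" "comp_fun e" "comp_fun a"
  shows "comp_pred (\<lambda>x. enumerated (t x) (e x) (a x))"
  unfolding enumerated_def by (intro comp_rules assms[THEN comp_fun_compose])

lemma ce_enumerated:
  assumes "ce A" obtains e where "A = {x. \<exists>t. enumerated t e x}"
proof -
  obtain f where f: "A = {x. \<exists>y. reval f [x] y}" using assms unfolding ce_def by blast
  have l: "list_encode [x] = lcons x 0" for x by (simp add: lcons_def)
  have "(\<exists>y. reval f [x] y) \<longleftrightarrow> (\<exists>t. enumerated t (recf_code f) x)" for x
  proof
    assume "\<exists>y. reval f [x] y"
    then obtain y where "\<forall>\<^sub>F k in sequentially. evals k (recf_code f) (lcons x 0) y"
      using evals_complete[of f "[x]"] unfolding l by blast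
    then obtain k where "evals k (recf_code f) (lcons x 0) y"
      by (auto simp: eventually_sequentially)
    then show "\<exists>t. enumerated t (recf_code f) x"
      unfolding enumerated_def by (intro exI[of _ "Suc (k + y)"] exI[of _ k] conjI exI[of _ y]) auto
  next
    assume "\<exists>t. enumerated t (recf_code f) x"
    then show "\<exists>y. reval f [x] y"
      unfolding enumerated_def using evals_sound[of _ f "[x]"] unfolding l by blast
  qed
  then show ?thesis using f that[of "recf_code f"] by simp
qed

section \<open>Binary strings and the uniform measure\<close>

text \<open>The first bit is the most significant one, so that strings of equal length are ordered lexicographically.\<close>
definition sval :: "bstr \<Rightarrow> nat" where
  "sval \<sigma> = foldl (\<lambda>v b. 2 * v + of_bool b) 0 \<sigma>"

lemma sval_Nil [simp]: "sval [] = 0"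
  and sval_snoc [simp]: "sval (\<sigma> @ [b]) = 2 * sval \<sigma> + of_bool b"
  by (simp_all add: sval_def)

lemma sval_less: "sval \<sigma> < 2 ^ length \<sigma>"
  by (induction \<sigma> rule: rev_induct) auto

text \<open>Each division by 2 removes the last bit. Prefixes thus become quotients by powers of
  two, the form used from here on.\<close>

lemma sval_append_div: "sval (\<sigma> @ \<tau>) div 2 ^ length \<tau> = sval \<sigma>"
proof (induction \<tau> rule: rev_induct)
  case (snoc b \<tau>)
  have "sval (\<sigma> @ \<tau> @ [b]) div 2 ^ length (\<tau> @ [b]) = sval ((\<sigma> @ \<tau>) @ [b]) div 2 div 2 ^ length \<tau>"
    by (simp add: div_mult2_eq)
  also have "\<dots> = sval (\<sigma> @ \<tau>) div 2 ^ length \<tau>"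
    unfolding sval_snoc by simp
  finally show ?case using snoc by simp
qed simp

lemma sval_inject: "length \<sigma> = length \<tau> \<Longrightarrow> sval \<sigma> = sval \<tau> \<Longrightarrow> \<sigma> = \<tau>"
proof (induction \<sigma> arbitrary: \<tau> rule: rev_induct)
  case (snoc b \<sigma>)
  then obtain \<tau>' c where \<tau>: "\<tau> = \<tau>' @ [c]" by (cases \<tau> rule: rev_cases) auto
  have eq: "2 * sval \<sigma> + of_bool b = 2 * sval \<tau>' + of_bool c" using snoc.prems \<tau> by simp
  then have "b = c" "sval \<sigma> = sval \<tau>'" by (cases b; cases c; simp; presburger)+
  then show ?case using snoc \<tau> by simp
qed simp

lemma sval_surj: "w < 2 ^ n \<Longrightarrow> \<exists>\<sigma>. length \<sigma> = n \<and> sval \<sigma> = w"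
proof (induction n arbitrary: w)
  case (Suc n)
  then obtain \<sigma> where "length \<sigma> = n" "sval \<sigma> = w div 2"
    using Suc.IH[of "w div 2"] less_mult_imp_div_less[of w "2 ^ n" 2] Suc.prems by (auto simp: mult.commute)
  then show ?case by (intro exI[of _ "\<sigma> @ [odd w]"]) (auto simp: odd_two_times_div_two_succ)
qed simp

definition seqval :: "cantor \<Rightarrow> nat \<Rightarrow> nat" where
  "seqval X n = sval (map X [0..<n])"

lemma seqval_0 [simp]: "seqval X 0 = 0"
  and seqval_Suc: "seqval X (Suc n) = 2 * seqval X n + of_bool (X n)"
  by (simp_all add: seqval_def)

lemma seqval_less: "seqval X n < 2 ^ n"
  using sval_less[of "map X [0..<n]"] by (simp add: seqval_def)

lemma seqval_div: "m \<le> n \<Longrightarrow> seqval X n div 2 ^ (n - m) = seqval X m"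
proof -
  assume "m \<le> n"
  then have "[0..<n] = [0..<m] @ [m..<n]" using upt_add_eq_append[of 0 m "n - m"] by simp
  then show ?thesis using sval_append_div[of "map X [0..<m]" "map X [m..<n]"] by (simp add: seqval_def)
qed

lemma prefix_of_iff_map: "prefix_of \<sigma> X \<longleftrightarrow> map X [0..<length \<sigma>] = \<sigma>"
  unfolding prefix_of_def list_eq_iff_nth_eq by (simp, blast)

lemma prefix_of_iff_seqval: "prefix_of \<sigma> X \<longleftrightarrow> seqval X (length \<sigma>) = sval \<sigma>"
  unfolding prefix_of_iff_map seqval_def using sval_inject[of "map X [0..<length \<sigma>]" \<sigma>] by auto

section \<open>Measure of sets determined by finitely many bits\<close>

lemma prob_space_lam: "prob_space lam"
  unfolding lam_def by (intro prob_space_PiM prob_space_measure_pmf)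

interpretation lam: prob_space lam by (rule prob_space_lam)

lemma prefix_of_sets: "{X. prefix_of \<sigma> X} \<in> sets lam"
  and measure_prefix_of: "measure lam {X. prefix_of \<sigma> X} = 1 / 2 ^ length \<sigma>"
proof -
  interpret product_prob_space "\<lambda>_::nat. measure_pmf (bernoulli_pmf (1/2))" UNIV
    by (intro product_prob_spaceI prob_space_measure_pmf)
  let ?M = "\<lambda>_::nat. measure_pmf (bernoulli_pmf (1/2))"
  have eq: "{X. prefix_of \<sigma> X} = prod_emb UNIV ?M {..<length \<sigma>} (\<Pi>\<^sub>E i\<in>{..<length \<sigma>}. {\<sigma> ! i})"
    by (auto simp: prod_emb_def prefix_of_def PiE_iff restrict_def extensional_def)
  show "{X. prefix_of \<sigma> X} \<in> sets lam"
    unfolding eq lam_def by (intro sets_PiM_I_finite measurable_prod_emb sets_PiM_I) auto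
  have "measure lam {X. prefix_of \<sigma> X} = (\<Prod>i<length \<sigma>. measure (measure_pmf (bernoulli_pmf (1/2))) {\<sigma> ! i})"
    unfolding eq lam_def by (intro measure_PiM_emb) auto
  also have "\<dots> = (\<Prod>i<length \<sigma>. 1/2)"
  proof (rule prod.cong)
    fix i
    show "measure (measure_pmf (bernoulli_pmf (1/2))) {\<sigma> ! i} = 1/2"
      by (cases "\<sigma> ! i") (simp_all add: measure_pmf_single)
  qed simp
  finally show "measure lam {X. prefix_of \<sigma> X} = 1 / 2 ^ length \<sigma>" by (simp add: power_one_over)
qed

lemma seqval_eq_sets: "{X. seqval X n = w} \<in> sets lam"
  and measure_seqval_eq: "w < 2 ^ n \<Longrightarrow> measure lam {X. seqval X n = w} = 1 / 2 ^ n"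
proof -
  have eq: "\<exists>\<sigma>. length \<sigma> = n \<and> {X. seqval X n = w} = {X. prefix_of \<sigma> X}" if "w < 2 ^ n"
    using sval_surj[OF that] by (auto simp: prefix_of_iff_seqval)
  then show "w < 2 ^ n \<Longrightarrow> measure lam {X. seqval X n = w} = 1 / 2 ^ n"
    using measure_prefix_of by metis
  show "{X. seqval X n = w} \<in> sets lam"
  proof (cases "w < 2 ^ n")
    case False
    then have "{X. seqval X n = w} = {}" using seqval_less by auto
    then show ?thesis by simp
  qed (use eq prefix_of_sets in metis)
qed

lemma seqval_Collect_sets: "{X. P (seqval X n)} \<in> sets lam"
  and measure_seqval_Collect: "measure lam {X. P (seqval X n)} = card {w. w < 2 ^ n \<and> P w} / 2 ^ n"
proof -
  let ?W = "{w. w < 2 ^ n \<and> P w}"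
  have eq: "{X. P (seqval X n)} = (\<Union>w\<in>?W. {X. seqval X n = w})" using seqval_less by auto
  show "{X. P (seqval X n)} \<in> sets lam"
    unfolding eq using seqval_eq_sets by (intro sets.finite_UN) auto
  have "measure lam {X. P (seqval X n)} = (\<Sum>w\<in>?W. measure lam {X. seqval X n = w})"
    unfolding eq using seqval_eq_sets
    by (intro lam.finite_measure_finite_Union) (auto simp: disjoint_family_on_def)
  also have "\<dots> = (\<Sum>w\<in>?W. 1 / 2 ^ n)"
    by (intro sum.cong) (auto simp: measure_seqval_eq)
  finally show "measure lam {X. P (seqval X n)} = card ?W / 2 ^ n" by simp
qed

lemma space_lam [simp]: "space lam = UNIV"
  by (simp add: lam_def space_PiM)

section \<open>Decoding of strings by computable functions\<close>

lemma str_code_surj: "\<exists>\<sigma>. str_code \<sigma> = c"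
proof (induction c rule: less_induct)
  case (less c)
  show ?case
  proof (cases "c = 0")
    case False
    then obtain \<sigma> where "str_code \<sigma> = (c - 1) div 2"
      using less[of "(c - 1) div 2"] less_mult_imp_div_less[of "c - 1" c 2] by auto
    then show ?thesis using False
      by (intro exI[of _ "even c # \<sigma>"]) (auto elim!: evenE oddE)
  qed (auto intro: exI[of _ "[]"])
qed

lemma str_code_eq_0_iff [simp]: "str_code \<sigma> = 0 \<longleftrightarrow> \<sigma> = []"
  by (cases \<sigma>) auto

lemma length_le_str_code: "length \<sigma> \<le> str_code \<sigma>"
  by (induction \<sigma>) auto

lemma str_code_replicate_False: "Suc (str_code (replicate n False)) = 2 ^ n"
  by (induction n) auto

lemma str_code_inject: "str_code \<sigma> = str_code \<tau> \<longleftrightarrow> \<sigma> = \<tau>"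
proof (induction \<sigma> arbitrary: \<tau>)
  case (Cons b \<sigma>)
  show ?case
  proof (cases \<tau>)
    case (Cons c \<tau>')
    have "str_code (b # \<sigma>) = str_code (c # \<tau>') \<longleftrightarrow> b = c \<and> str_code \<sigma> = str_code \<tau>'"
      by (cases b; cases c; simp; presburger)
    then show ?thesis using Cons.IH[of \<tau>'] Cons by simp
  qed simp
qed (metis str_code_eq_0_iff str_code.simps(1))

text \<open>In bijective base 2 the first bit is the lowest digit, 1 or 2, so subtracting 1 and
  halving removes it; the code 0 of the empty string stays 0 by truncated subtraction.\<close>

definition code_drop :: "nat \<Rightarrow> nat \<Rightarrow> nat" where
  "code_drop i c = rec_nat c (\<lambda>_ y. (y - 1) div 2 ^ 1) i"

definition code_len :: "nat \<Rightarrow> nat" where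
  "code_len c = (\<Sum>i<c. of_bool (code_drop i c \<noteq> 0))"

text \<open>A digit 2 stands for \<open>True\<close>, so a bit is read off as evenness of the
  remaining code.\<close>

definition code_val :: "nat \<Rightarrow> nat" where
  "code_val c = (\<Sum>i<code_len c. of_bool (\<not> odd (code_drop i c)) * 2 ^ (code_len c - Suc i))"

lemma code_drop_str_code: "code_drop i (str_code \<sigma>) = str_code (drop i \<sigma>)"
proof (induction i)
  case (Suc i)
  have "(str_code \<tau> - 1) div 2 = str_code (tl \<tau>)" for \<tau> by (cases \<tau>) auto
  then show ?case using Suc by (simp add: code_drop_def drop_Suc tl_drop)
qed (simp add: code_drop_def)

lemma code_len_str_code [simp]: "code_len (str_code \<sigma>) = length \<sigma>"
proof -
  have "{i. i < str_code \<sigma> \<and> i < length \<sigma>} = {..<length \<sigma>}" using length_le_str_code[of \<sigma>] by auto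
  moreover have "code_len (str_code \<sigma>) = card {i. i < str_code \<sigma> \<and> i < length \<sigma>}"
    by (simp add: code_len_def code_drop_str_code Int_def not_le del: sum_of_bool_eq)
       (simp add: Int_def)
  ultimately show ?thesis by simp
qed

lemma sval_eq_sum: "sval \<sigma> = (\<Sum>i<length \<sigma>. of_bool (\<sigma> ! i) * 2 ^ (length \<sigma> - Suc i))"
proof (induction \<sigma> rule: rev_induct)
  case (snoc b \<sigma>)
  have "(\<Sum>i<length \<sigma>. of_bool ((\<sigma> @ [b]) ! i) * (2 :: nat) ^ (length (\<sigma> @ [b]) - Suc i)) =
      2 * (\<Sum>i<length \<sigma>. of_bool (\<sigma> ! i) * 2 ^ (length \<sigma> - Suc i))"
    unfolding sum_distrib_left
    by (intro sum.cong) (auto simp: nth_append Suc_diff_Suc[symmetric])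
  then show ?case using snoc by simp
qed simp

lemma code_val_str_code [simp]: "code_val (str_code \<sigma>) = sval \<sigma>"
proof -
  have "\<not> odd (str_code (drop i \<sigma>)) \<longleftrightarrow> \<sigma> ! i" if "i < length \<sigma>" for i
    using Cons_nth_drop_Suc[OF that, symmetric] by simp
  then show ?thesis
    unfolding code_val_def sval_eq_sum by (intro sum.cong) (auto simp: code_drop_str_code)
qed

lemma comp_fun_code_drop: "comp_fun f \<Longrightarrow> comp_fun g \<Longrightarrow> comp_fun (\<lambda>x. code_drop (f x) (g x))"
  unfolding code_drop_def by (intro comp_fun_rec_nat comp_rules)

lemma comp_fun_code_len:
  assumes "comp_fun f" shows "comp_fun (\<lambda>x. code_len (f x))"
  unfolding code_len_def by (intro comp_rules comp_fun_code_drop assms assms[THEN comp_fun_compose])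

lemma comp_fun_code_val:
  assumes "comp_fun f" shows "comp_fun (\<lambda>x. code_val (f x))"
  unfolding code_val_def
  by (intro comp_rules comp_fun_code_drop comp_fun_code_len assms assms[THEN comp_fun_compose])

lemmas [comp_rules] = comp_fun_code_len comp_fun_code_val

section \<open>A left-c.e. random sequence\<close>

text \<open>\<open>covers e t w\<close>: by stage \<open>t\<close>, level \<open>e + 2\<close> of the \<open>e\<close>-th candidate for a Martin-Loef test
  contains a prefix of the string of length \<open>t\<close> with value \<open>w\<close>.\<close>
definition covers :: "nat \<Rightarrow> nat \<Rightarrow> nat \<Rightarrow> bool" where
  "covers e t w \<longleftrightarrow> (\<exists>c<t. enumerated t e (prod_encode (e + 2, c)) \<and> code_len c \<le> t \<and>
     code_val c = w div 2 ^ (t - code_len c))"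

text \<open>The part of that level enumerated by stage \<open>t\<close> respects the measure bound \<open>2 ^ -(e + 2)\<close>;
  ignoring the other stages turns an arbitrary c.e. set into a test.\<close>
definition admissible :: "nat \<Rightarrow> nat \<Rightarrow> bool" where
  "admissible e t \<longleftrightarrow> (\<Sum>w<2 ^ t. of_bool (covers e t w)) * 2 ^ (e + 2) \<le> (2 ^ t :: nat)"

text \<open>The finite-stage version of the open set to be avoided, with tests \<open>e < s\<close>
  and stages \<open>t \<le> s\<close>; the quotient is the prefix of length
  \<open>t\<close>.\<close>

definition blocked :: "nat \<Rightarrow> nat \<Rightarrow> bool" where
  "blocked s v \<longleftrightarrow> (\<exists>e<s. \<exists>t<Suc s. admissible e t \<and> covers e t (v div 2 ^ (s - t)))"

definition leftmost :: "nat \<Rightarrow> nat" where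
  "leftmost s = (LEAST v. \<not> blocked s v)"

lemma comp_pred_covers:
  assumes "comp_fun e" "comp_fun t" "comp_fun w"
  shows "comp_pred (\<lambda>x. covers (e x) (t x) (w x))"
  unfolding covers_def by (intro comp_rules comp_pred_enumerated assms assms[THEN comp_fun_compose])

lemma comp_pred_blocked:
  assumes "comp_fun s" "comp_fun v"
  shows "comp_pred (\<lambda>x. blocked (s x) (v x))"
  unfolding blocked_def admissible_def
  by (intro comp_rules comp_pred_covers assms assms[THEN comp_fun_compose])

lemma measure_covers_le:
  assumes "admissible e t"
  shows "measure lam {X. covers e t (seqval X t)} \<le> 1 / 2 ^ (e + 2)"
proof -
  have "card {w. w < 2 ^ t \<and> covers e t w} * 2 ^ (e + 2) \<le> (2 ^ t :: nat)"
    using assms by (simp add: admissible_def Int_def)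
  then have "real (card {w. w < 2 ^ t \<and> covers e t w} * 2 ^ (e + 2)) \<le> real (2 ^ t)"
    unfolding of_nat_le_iff .
  then show ?thesis unfolding measure_seqval_Collect by (simp add: field_simps)
qed

lemma admissibleI:
  assumes "measure lam {X. covers e t (seqval X t)} \<le> 1 / 2 ^ (e + 2)"
  shows "admissible e t"
proof -
  have "real (card {w. w < 2 ^ t \<and> covers e t w} * 2 ^ (e + 2)) \<le> real (2 ^ t)"
    using assms unfolding measure_seqval_Collect by (simp add: field_simps)
  then have "card {w. w < 2 ^ t \<and> covers e t w} * 2 ^ (e + 2) \<le> (2 ^ t :: nat)"
    unfolding of_nat_le_iff .
  then show ?thesis by (simp add: admissible_def Int_def)
qed

lemma covers_mono:
  assumes "covers e t (seqval X t)" "t \<le> u"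
  shows "covers e u (seqval X u)"
proof -
  obtain c where c: "c < t" "enumerated t e (prod_encode (e + 2, c))" "code_len c \<le> t"
      "code_val c = seqval X t div 2 ^ (t - code_len c)"
    using assms(1) unfolding covers_def by blast
  have "seqval X t div 2 ^ (t - code_len c) = seqval X u div 2 ^ (u - code_len c)"
    using seqval_div[of "code_len c" t X] seqval_div[of "code_len c" u X] c(3) assms(2) by simp
  then show ?thesis unfolding covers_def
    using c assms(2) enumerated_mono by (intro exI[of _ c]) auto
qed

text \<open>For fixed \<open>e\<close> the covered sets grow with \<open>t\<close>, so the last
  admissible stage up to \<open>s\<close> contains all the others and has measure at most
  \<open>1 / 2 ^ (e + 2)\<close>. These bounds sum to less than 1/2, which leaves a sequence
  uncovered.\<close>

lemma ex_not_blocked: "\<exists>v<2 ^ s. \<not> blocked s v"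
proof -
  define A where "A e = {X. \<exists>t<Suc s. admissible e t \<and> covers e t (seqval X s div 2 ^ (s - t))}" for e
  have sets: "A e \<in> sets lam" for e
    unfolding A_def using seqval_Collect_sets[of _ s] .
  have A: "measure lam (A e) \<le> (1 / 2) ^ (e + 2)" for e
  proof (cases "\<exists>t\<le>s. admissible e t")
    case True
    define u where "u = Max {t. t \<le> s \<and> admissible e t}"
    have "u \<in> {t. t \<le> s \<and> admissible e t}" unfolding u_def using True by (intro Max_in) auto
    then have u: "admissible e u" by simp
    have "t \<le> u" if "t \<le> s" "admissible e t" for t
      unfolding u_def using that by (intro Max_ge) auto
    then have "A e \<subseteq> {X. covers e u (seqval X u)}"
      unfolding A_def using covers_mono[of e _ _ u] by (auto simp: seqval_div)
    then have "measure lam (A e) \<le> measure lam {X. covers e u (seqval X u)}"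
      by (intro lam.finite_measure_mono seqval_Collect_sets)
    also have "\<dots> \<le> (1 / 2) ^ (e + 2)" using measure_covers_le[OF u] by (simp add: power_one_over)
    finally show ?thesis .
  next
    case False
    then have "A e = {}" by (auto simp: A_def)
    then show ?thesis by simp
  qed
  have "measure lam (\<Union>e<s. A e) \<le> (\<Sum>e<s. measure lam (A e))"
    using sets by (intro lam.finite_measure_subadditive_finite) auto
  also have "\<dots> \<le> (\<Sum>e<s. (1 / 2) ^ (e + 2))" by (intro sum_mono A)
  also have "\<dots> = 1 / 2 - (1 / 2) ^ (s + 1)" by (induction s) auto
  also have "\<dots> < 1" using zero_less_power[of "1 / 2 :: real" "s + 1"] by linarith
  finally have "(\<Union>e<s. A e) \<noteq> UNIV" using lam.prob_space by auto
  then obtain X where "\<And>e. e < s \<Longrightarrow> X \<notin> A e" by blast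
  then have "\<not> blocked s (seqval X s)" by (auto simp: blocked_def A_def)
  then show ?thesis using seqval_less by blast
qed

lemma leftmost_less: "leftmost s < 2 ^ s"
  and not_blocked_leftmost: "\<not> blocked s (leftmost s)"
proof -
  obtain v where v: "v < 2 ^ s" "\<not> blocked s v" using ex_not_blocked by blast
  show "\<not> blocked s (leftmost s)" unfolding leftmost_def by (rule LeastI) (rule v(2))
  have "leftmost s \<le> v" unfolding leftmost_def by (rule Least_le) (rule v(2))
  then show "leftmost s < 2 ^ s" using v(1) by simp
qed

lemma blocked_of_less_leftmost: "v < leftmost s \<Longrightarrow> blocked s v"
  unfolding leftmost_def using not_less_Least by blast

text \<open>Only bounded quantification over the decidable \<open>blocked\<close> occurs, so the
  graph of \<open>leftmost\<close> is decidable; in this form \<open>leftmost\<close> enters the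
  c.e. definitions later.\<close>

lemma leftmost_eq_iff: "v = leftmost s \<longleftrightarrow> \<not> blocked s v \<and> (\<forall>u<v. blocked s u)"
  using not_blocked_leftmost blocked_of_less_leftmost by (metis linorder_neqE_nat)

lemma div_power2_div: "m \<le> n \<Longrightarrow> n \<le> s \<Longrightarrow> v div 2 ^ (s - n) div 2 ^ (n - m) = v div 2 ^ (s - m)"
  for v :: nat
  by (simp add: div_mult2_eq[symmetric] power_add[symmetric])

text \<open>Blocking is inherited by extensions at later stages, so the restriction of an unblocked
  string of length \<open>t\<close> to length \<open>s\<close> is unblocked at
  \<open>s\<close>.\<close>

lemma leftmost_le_div:
  assumes "s \<le> t" shows "leftmost s \<le> leftmost t div 2 ^ (t - s)"
proof -
  have "\<not> blocked s (leftmost t div 2 ^ (t - s))"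
  proof
    assume "blocked s (leftmost t div 2 ^ (t - s))"
    then obtain e u where "e < s" "u \<le> s" "admissible e u"
        "covers e u (leftmost t div 2 ^ (t - s) div 2 ^ (s - u))"
      unfolding blocked_def by (metis less_Suc_eq_le)
    then have "blocked t (leftmost t)"
      unfolding blocked_def using assms
      by (intro exI[of _ e] exI[of _ u] conjI) (auto simp: div_power2_div)
    then show False using not_blocked_leftmost by blast
  qed
  then show ?thesis unfolding leftmost_def by (rule Least_le)
qed

lemma leftmost_prefix_mono:
  assumes "n \<le> s" "s \<le> t" shows "leftmost s div 2 ^ (s - n) \<le> leftmost t div 2 ^ (t - n)"
  using div_le_mono[OF leftmost_le_div[OF assms(2)], of "2 ^ (s - n)"] assms
  by (simp add: div_power2_div)

text \<open>Suppose a test with index \<open>e\<close> captures \<open>X\<close>. Some prefix of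
  \<open>X\<close> is enumerated into level \<open>e + 2\<close>; at a late stage \<open>t\<close>
  it covers \<open>X\<close>, and that stage is admissible because everything it covers lies in
  level \<open>e + 2\<close>, whose measure is bounded.\<close>

lemma MLR_if_not_covered:
  assumes "\<And>e t. admissible e t \<Longrightarrow> \<not> covers e t (seqval X t)"
  shows "X \<in> MLR"
  unfolding MLR_def
proof (intro CollectI allI impI notI)
  fix U assume U: "mltest U" and X: "\<forall>n. X \<in> cyl (U n)"
  obtain e where e: "{prod_encode (n, str_code \<sigma>) | n \<sigma>. \<sigma> \<in> U n} = {x. \<exists>t. enumerated t e x}"
    using U ce_enumerated unfolding mltest_def uniformly_ce_def by blast
  have in_U: "\<sigma> \<in> U n" if "str_code \<sigma> = c" "enumerated t e (prod_encode (n, c))" for \<sigma> c t n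
  proof -
    have "prod_encode (n, str_code \<sigma>) \<in> {prod_encode (n, str_code \<sigma>) | n \<sigma>. \<sigma> \<in> U n}"
      unfolding e using that by blast
    then show ?thesis by (auto simp: str_code_inject)
  qed
  obtain \<sigma> where \<sigma>: "\<sigma> \<in> U (e + 2)" "prefix_of \<sigma> X"
    using X unfolding cyl_def by blast
  then obtain s where s: "enumerated s e (prod_encode (e + 2, str_code \<sigma>))" using e by blast
  \<comment> \<open>Besides enumeration of the string, \<open>covers\<close> requires its code below
    \<open>t\<close> and its length at most \<open>t\<close>.\<close>
  define t where "t = s + Suc (str_code \<sigma>)"
  have t: "s \<le> t" "str_code \<sigma> < t" by (auto simp: t_def)
  have len: "length \<sigma> \<le> t" using length_le_str_code[of \<sigma>] t by simp
  have cov: "covers e t (seqval X t)"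
    unfolding covers_def using \<sigma>(2) t len enumerated_mono[OF s t(1)]
    by (intro exI[of _ "str_code \<sigma>"]) (auto simp: seqval_div prefix_of_iff_seqval)
  have sub: "{Y. covers e t (seqval Y t)} \<subseteq> cyl (U (e + 2))"
  proof
    fix Y assume "Y \<in> {Y. covers e t (seqval Y t)}"
    then obtain c where c: "enumerated t e (prod_encode (e + 2, c))" "code_len c \<le> t"
        "code_val c = seqval Y t div 2 ^ (t - code_len c)"
      unfolding covers_def by blast
    obtain \<tau> where \<tau>: "str_code \<tau> = c" using str_code_surj by blast
    then have "prefix_of \<tau> Y" using c by (auto simp: seqval_div prefix_of_iff_seqval)
    then show "Y \<in> cyl (U (e + 2))" using in_U[OF \<tau> c(1)] unfolding cyl_def by blast
  qed
  have "cyl (U (e + 2)) = (\<Union>\<tau>\<in>U (e + 2). {Y. prefix_of \<tau> Y})" by (auto simp: cyl_def)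
  then have "cyl (U (e + 2)) \<in> sets lam" using prefix_of_sets by (auto intro!: sets.countable_UN')
  then have "emeasure lam {Y. covers e t (seqval Y t)} \<le> emeasure lam (cyl (U (e + 2)))"
    using sub by (intro emeasure_mono)
  also have "\<dots> \<le> ennreal ((1 / 2) ^ (e + 2))" using U unfolding mltest_def by blast
  finally have "measure lam {Y. covers e t (seqval Y t)} \<le> (1 / 2) ^ (e + 2)"
    by (simp add: lam.emeasure_eq_measure)
  then have "admissible e t" by (intro admissibleI) (simp add: power_one_over)
  then show False using assms cov by blast
qed

section \<open>The limit of the approximations and its randomness\<close>

lemma mono_bounded_eventually_const:
  fixes f :: "nat \<Rightarrow> nat"
  assumes mono: "\<And>s t. n \<le> s \<Longrightarrow> s \<le> t \<Longrightarrow> f s \<le> f t" and bound: "\<And>s. n \<le> s \<Longrightarrow> f s < b"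
  shows "\<exists>q. \<forall>\<^sub>F s in sequentially. f s = q"
proof -
  have "f ` {n..} \<subseteq> {..<b}" using bound by auto
  then have fin: "finite (f ` {n..})" by (rule finite_subset) simp
  then have "Max (f ` {n..}) \<in> f ` {n..}" by (intro Max_in) auto
  then obtain s where s: "s \<ge> n" "f s = Max (f ` {n..})" by auto
  have "f t = f s" if "t \<ge> s" for t
    using mono[OF s(1) that] Max_ge[OF fin, of "f t"] s that by simp
  then show ?thesis unfolding eventually_sequentially by blast
qed

text \<open>For fixed \<open>n\<close> the prefixes of length \<open>n\<close> increase with the
  stage and stay below \<open>2 ^ n\<close>, hence settle. Settled values of successive lengths
  differ by one appended bit, so they fit together to one sequence.\<close>

lemma leftmost_limit:
  obtains X where "\<And>n. \<forall>\<^sub>F s in sequentially. leftmost s div 2 ^ (s - n) = seqval X n"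
proof -
  have "\<exists>q. \<forall>\<^sub>F s in sequentially. leftmost s div 2 ^ (s - n) = q" for n
  proof (rule mono_bounded_eventually_const[where n = n and b = "2 ^ n"])
    fix s assume "n \<le> s"
    then show "leftmost s div 2 ^ (s - n) < 2 ^ n"
      using leftmost_less[of s] by (simp add: less_mult_imp_div_less power_add[symmetric])
  qed (rule leftmost_prefix_mono)
  then obtain Q where Q: "\<And>n. \<forall>\<^sub>F s in sequentially. leftmost s div 2 ^ (s - n) = Q n" by metis
  define X where "X n = odd (Q (Suc n))" for n
  have "Q n = seqval X n" for n
  proof (induction n)
    case 0
    obtain s where "leftmost s div 2 ^ (s - 0) = Q 0"
      using Q[of 0] by (auto simp: eventually_sequentially)
    then show ?case using leftmost_less[of s] by simp
  next
    case (Suc n)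
    have "\<forall>\<^sub>F s in sequentially. Q n = Q (Suc n) div 2"
      using Q[of n] Q[of "Suc n"] eventually_ge_at_top[of "Suc n"]
    proof eventually_elim
      case (elim s)
      then show ?case using div_power2_div[of n "Suc n" s "leftmost s"] by simp
    qed
    then have "Q n = Q (Suc n) div 2" by simp
    then show ?case using Suc by (simp add: seqval_Suc X_def)
  qed
  then show ?thesis using that[of X] Q by simp
qed

text \<open>Take a stage \<open>s > e + t\<close> at which the prefix of length \<open>t\<close> has
  settled. If an admissible \<open>t\<close> covered this prefix, the leftmost string would be
  blocked at stage \<open>s\<close>.\<close>

lemma leftmost_limit_MLR:
  assumes lim: "\<And>n. \<forall>\<^sub>F s in sequentially. leftmost s div 2 ^ (s - n) = seqval X n"
  shows "X \<in> MLR"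
proof (rule MLR_if_not_covered)
  fix e t assume adm: "admissible e t"
  have "\<forall>\<^sub>F s in sequentially. \<not> covers e t (seqval X t)"
    using lim[of t] eventually_gt_at_top[of "e + t"]
  proof eventually_elim
    case (elim s)
    then show ?case using not_blocked_leftmost[of s] adm unfolding blocked_def
      by (metis add_lessD1 add.commute less_SucI)
  qed
  then show "\<not> covers e t (seqval X t)" by simp
qed

section \<open>Functionals with output in 0*\<close>

text \<open>The output is as long as the input used, so \<open>P n\<close> says which prefixes of
  length \<open>n\<close> yield \<open>n\<close> zeros.\<close>

definition zero_functional :: "(nat \<Rightarrow> nat \<Rightarrow> bool) \<Rightarrow> (bstr \<times> bstr) set" where
  "zero_functional P = {(\<sigma>, replicate (length \<sigma>) False) | \<sigma>. P (length \<sigma>) (sval \<sigma>)}"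

text \<open>\<open>R\<close> verifies a witness \<open>s\<close> for \<open>P\<close>, so membership
  in the functional is a projection of a decidable predicate. Any two strings of zeros are
  comparable, which gives consistency.\<close>

lemma turing_functional_zero:
  assumes R: "comp_pred R" and P: "\<And>n w. P n w \<longleftrightarrow> (\<exists>s. R (prod_encode (prod_encode (n, w), s)))"
  shows "turing_functional (zero_functional P)"
proof -
  \<comment> \<open>The string of \<open>n\<close> zeros has code \<open>2 ^ n - 1\<close>, so the
    first conjunct says that the second string consists of as many zeros as the first has
    bits.\<close>
  let ?Q = "\<lambda>x. Suc (psnd (pfst x)) = 2 ^ code_len (pfst (pfst x)) \<and>
      R (prod_encode (prod_encode (code_len (pfst (pfst x)), code_val (pfst (pfst x))), psnd x))"
  have comp: "comp_pred ?Q"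
    by (intro comp_rules comp_pred_compose[OF R])
  have eq: "(\<lambda>(\<sigma>, \<tau>). prod_encode (str_code \<sigma>, str_code \<tau>)) ` zero_functional P =
      {x. \<exists>s. ?Q (prod_encode (x, s))}"
  proof (intro set_eqI iffI)
    fix x assume "x \<in> (\<lambda>(\<sigma>, \<tau>). prod_encode (str_code \<sigma>, str_code \<tau>)) ` zero_functional P"
    then show "x \<in> {x. \<exists>s. ?Q (prod_encode (x, s))}"
      by (auto simp: zero_functional_def P str_code_replicate_False)
  next
    fix x assume "x \<in> {x. \<exists>s. ?Q (prod_encode (x, s))}"
    then obtain s where s: "?Q (prod_encode (x, s))" by blast
    obtain \<sigma> where \<sigma>: "pfst x = str_code \<sigma>" using str_code_surj by metis
    have "P (length \<sigma>) (sval \<sigma>)" using s \<sigma> by (auto simp: P)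
    moreover have "Suc (psnd x) = Suc (str_code (replicate (length \<sigma>) False))"
      unfolding str_code_replicate_False using s \<sigma> by simp
    then have "x = prod_encode (str_code \<sigma>, str_code (replicate (length \<sigma>) False))"
      using \<sigma> by (metis Suc_inject prod_encode_pfst_psnd)
    ultimately show "x \<in> (\<lambda>(\<sigma>, \<tau>). prod_encode (str_code \<sigma>, str_code \<tau>)) ` zero_functional P"
      by (force simp: zero_functional_def)
  qed
  have "ce_strpairs (zero_functional P)"
    unfolding ce_strpairs_def eq by (rule ce_projection[OF comp])
  moreover have "comparable (replicate m False) (replicate n False)" for m n
    unfolding comparable_def prefix_def
    by (metis le_add_diff_inverse nat_le_linear replicate_add)
  ultimately show ?thesis unfolding turing_functional_def zero_functional_def by blast
qed

definition nested :: "(nat \<Rightarrow> nat \<Rightarrow> bool) \<Rightarrow> bool" where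
  "nested P \<longleftrightarrow> (\<forall>n w. P (Suc n) w \<longrightarrow> P n (w div 2))"

lemma nested_seqval:
  assumes "nested P" "P n (seqval X n)" "m \<le> n"
  shows "P m (seqval X m)"
  using assms(3,2)
proof (induction rule: dec_induct)
  case (step n)
  have "P n (seqval X (Suc n) div 2)" using assms(1) step.prems unfolding nested_def by blast
  then show ?case using step.IH by (simp add: seqval_Suc)
qed

text \<open>Output position \<open>n\<close> requires a string of length at least
  \<open>Suc n\<close>; nestedness passes from any longer one to length exactly
  \<open>Suc n\<close>.\<close>

lemma tf_out_zero:
  assumes nested: "nested P"
  shows "tf_out (zero_functional P) X n = (if P (Suc n) (seqval X (Suc n)) then Some False else None)"
proof -
  have val: "tf_val (zero_functional P) X n b \<longleftrightarrow> \<not> b \<and> P (Suc n) (seqval X (Suc n))" for b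
  proof
    assume "tf_val (zero_functional P) X n b"
    then obtain \<sigma> where "P (length \<sigma>) (sval \<sigma>)" "prefix_of \<sigma> X" "n < length \<sigma>" "\<not> b"
      by (auto simp: tf_val_def zero_functional_def)
    then show "\<not> b \<and> P (Suc n) (seqval X (Suc n))"
      using nested_seqval[OF nested, of "length \<sigma>" X "Suc n"] by (simp add: prefix_of_iff_seqval)
  next
    assume "\<not> b \<and> P (Suc n) (seqval X (Suc n))"
    moreover define \<sigma> where "\<sigma> = map X [0..<Suc n]"
    ultimately have "(\<sigma>, replicate (Suc n) False) \<in> zero_functional P" "prefix_of \<sigma> X" "\<not> b"
      by (auto simp: zero_functional_def prefix_of_iff_map seqval_def simp del: upt_Suc)
    then show "tf_val (zero_functional P) X n b"
      unfolding tf_val_def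
      by (intro exI[of _ \<sigma>] exI[of _ "replicate (Suc n) False"])
         (simp add: nth_replicate del: replicate_Suc)
  qed
  have "(SOME b. \<not> b) = False" by (rule some_equality) auto
  then show ?thesis unfolding tf_out_def val by auto
qed

text \<open>Only the number of strings accepted by \<open>P\<close> at each length enters, so
  rearranging these strings leaves the semi-measure unchanged. \<open>P 0 0\<close> accounts for the
  empty \<open>\<sigma>\<close>, which every output extends.\<close>

lemma induced_sm_zero:
  assumes nested: "nested P" and "P 0 0"
  shows "induced_sm (zero_functional P) \<sigma> =
    (if True \<in> set \<sigma> then 0 else ennreal (card {w. w < 2 ^ length \<sigma> \<and> P (length \<sigma>) w} / 2 ^ length \<sigma>))"
proof -
  have out: "out_extends (zero_functional P) X \<sigma> \<longleftrightarrow>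
      (\<forall>i<length \<sigma>. P (Suc i) (seqval X (Suc i)) \<and> \<not> \<sigma> ! i)" for X
    unfolding out_extends_def tf_out_zero[OF nested] by auto
  show ?thesis
  proof (cases "True \<in> set \<sigma>")
    case True
    then have "{X. out_extends (zero_functional P) X \<sigma>} = {}" by (auto simp: out in_set_conv_nth)
    then show ?thesis using True by (simp add: induced_sm_def)
  next
    case False
    have "out_extends (zero_functional P) X \<sigma> \<longleftrightarrow> P (length \<sigma>) (seqval X (length \<sigma>))" for X
    proof (cases "length \<sigma>")
      case 0
      then show ?thesis unfolding out using \<open>P 0 0\<close> by simp
    next
      case (Suc n)
      have "\<not> \<sigma> ! i" if "i < length \<sigma>" for i using False that nth_mem by fastforce
      then show ?thesis unfolding out Suc using nested_seqval[OF nested, of "Suc n" X] by (auto simp: Suc_le_eq)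
    qed
    then show ?thesis
      using False by (simp add: induced_sm_def lam.emeasure_eq_measure measure_seqval_Collect)
  qed
qed

lemma tf_dom_zero:
  assumes "nested P" and "P 0 0"
  shows "tf_dom (zero_functional P) = {X. \<forall>n. P n (seqval X n)}"
proof -
  have "(\<forall>n. P n (seqval X n)) \<longleftrightarrow> (\<forall>n. P (Suc n) (seqval X (Suc n)))" for X
    using \<open>P 0 0\<close> by (metis not0_implies_Suc seqval_0)
  then show ?thesis by (auto simp: tf_dom_def tf_out_zero[OF assms(1)] split: if_splits)
qed

section \<open>The all-zero sequence and the two functionals\<close>

lemma zero_seq_not_MLR: "(\<lambda>_. False) \<notin> MLR"
proof -
  define U where "U n = {replicate n False}" for n :: nat
  have eq: "{prod_encode (n, str_code \<sigma>) | n \<sigma>. \<sigma> \<in> U n} =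
      {x. \<exists>s. Suc (psnd (pfst (prod_encode (x, s)))) = 2 ^ pfst (pfst (prod_encode (x, s)))}"
  proof (intro set_eqI iffI)
    fix x assume "x \<in> {x. \<exists>s. Suc (psnd (pfst (prod_encode (x, s)))) = 2 ^ pfst (pfst (prod_encode (x, s)))}"
    then have "psnd x = str_code (replicate (pfst x) False)"
      using str_code_replicate_False[of "pfst x"] by simp
    then have "x = prod_encode (pfst x, str_code (replicate (pfst x) False))"
      by (metis prod_encode_pfst_psnd)
    then show "x \<in> {prod_encode (n, str_code \<sigma>) | n \<sigma>. \<sigma> \<in> U n}" by (auto simp: U_def)
  qed (auto simp: U_def str_code_replicate_False)
  have comp: "comp_pred (\<lambda>z. Suc (psnd (pfst z)) = 2 ^ pfst (pfst z))"
    by (intro comp_rules)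
  have "uniformly_ce U" unfolding uniformly_ce_def eq by (rule ce_projection[OF comp])
  moreover have "cyl (U n) = {X. prefix_of (replicate n False) X}" for n
    by (auto simp: cyl_def U_def)
  then have "emeasure lam (cyl (U n)) = ennreal ((1/2) ^ n)" for n
    by (simp add: lam.emeasure_eq_measure measure_prefix_of power_one_over)
  ultimately have "mltest U" by (simp add: mltest_def)
  moreover have "(\<lambda>_. False) \<in> cyl (U n)" for n by (auto simp: cyl_def U_def prefix_of_def)
  ultimately show ?thesis unfolding MLR_def by blast
qed

lemma comp_pred_eq_leftmost:
  assumes "comp_fun v" "comp_fun s" shows "comp_pred (\<lambda>x. v x = leftmost (s x))"
  unfolding leftmost_eq_iff by (intro comp_rules comp_pred_blocked assms assms[THEN comp_fun_compose])

text \<open>Numbers with equal quotients lie in the same block of length \<open>d\<close>. This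
  bounds the gap between \<open>leftmost m\<close> and the restriction of the limit once a prefix
  has settled.\<close>

lemma less_add_if_div_eq:
  fixes a b d :: nat
  assumes "a div d = b div d" "0 < d" shows "b < a + d"
proof -
  have "b = a div d * d + b mod d" unfolding assms(1) by simp
  moreover have "a div d * d \<le> a" by simp
  ultimately show ?thesis using mod_less_divisor[OF assms(2), of b] by linarith
qed

theorem theorem4p1:
  shows "\<exists>\<Phi> \<Psi>. turing_functional \<Phi> \<and> turing_functional \<Psi> \<and>
           induced_sm \<Phi> = induced_sm \<Psi> \<and> tf_image \<Phi> MLR \<noteq> tf_image \<Psi> MLR"
proof -
  obtain X where lim: "\<And>n. \<forall>\<^sub>F s in sequentially. leftmost s div 2 ^ (s - n) = seqval X n"
    using leftmost_limit by metis
  have lim_ge: "\<exists>s\<ge>n. leftmost s div 2 ^ (s - m) = seqval X m" for m n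
    using eventually_conj[OF lim[of m] eventually_ge_at_top[of n]]
    by (auto simp: eventually_sequentially)
  have le_limit: "leftmost s div 2 ^ (s - n) \<le> seqval X n" if "n \<le> s" for n s
  proof -
    obtain t where "s \<le> t" "leftmost t div 2 ^ (t - n) = seqval X n" using lim_ge by blast
    then show ?thesis using leftmost_prefix_mono[of n s t] that by simp
  qed
  \<comment> \<open>Values at finite stages never exceed the limit, and the limit is attained, so
    \<open>a \<le> seqval X n\<close> is confirmed at some stage. This makes it a c.e.
    condition.\<close>
  have ce_iff: "a \<le> seqval X n \<longleftrightarrow> (\<exists>s\<ge>n. a \<le> leftmost s div 2 ^ (s - n))" for a n
    using lim_ge[of n n] le_limit[of n] by (metis order_trans)
  have le: "leftmost n \<le> seqval X n" for n using le_limit[of n n] by simp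
  have half: "leftmost n \<le> leftmost (Suc n) div 2" for n using leftmost_le_div[of n "Suc n"] by simp
  have X_half: "seqval X n = seqval X (Suc n) div 2" for n by (simp add: seqval_Suc)

  define P where "P n w \<longleftrightarrow> leftmost n \<le> w \<and> w \<le> seqval X n" for n w
  \<comment> \<open>The interval of \<open>P\<close> translated to start at 0, written additively to
    avoid truncated subtraction.\<close>
  define Q where "Q n w \<longleftrightarrow> w + leftmost n \<le> seqval X n" for n w
  let ?\<Phi> = "zero_functional P" and ?\<Psi> = "zero_functional Q"

  have P_nested: "nested P"
    unfolding nested_def
  proof (intro allI impI)
    fix n w assume "P (Suc n) w"
    then show "P n (w div 2)"
      using half[of n] X_half[of n] div_le_mono[of "leftmost (Suc n)" w 2] div_le_mono[of w "seqval X (Suc n)" 2]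
      unfolding P_def by simp
  qed
  have Q_nested: "nested Q"
    unfolding nested_def
  proof (intro allI impI)
    fix n w assume "Q (Suc n) w"
    \<comment> \<open>Halving rounds down, so the sum of the halves of \<open>w\<close> and
      \<open>leftmost (Suc n)\<close> is at most the half of their sum.\<close>
    then show "Q n (w div 2)" using half[of n] X_half[of n] unfolding Q_def by linarith
  qed
  have P0: "P 0 0" and Q0: "Q 0 0" using le[of 0] by (auto simp: P_def Q_def)

  \<comment> \<open>Below, \<open>x\<close> codes \<open>((n, w), (s, (leftmost n, leftmost s)))\<close>.\<close>
  define n where "n x = pfst (pfst x)" for x
  define w where "w x = psnd (pfst x)" for x
  define s where "s x = pfst (psnd x)" for x
  define a where "a x = pfst (psnd (psnd x))" for x
  define b where "b x = psnd (psnd (psnd x))" for x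
  note defs = n_def w_def s_def a_def b_def
  have "turing_functional ?\<Phi>"
  proof (rule turing_functional_zero)
    \<comment> \<open>The values of \<open>leftmost\<close> are guessed as part of the witness, so
      its decidable graph suffices.\<close>
    show "comp_pred (\<lambda>x. n x \<le> s x \<and> a x = leftmost (n x) \<and> b x = leftmost (s x) \<and>
        a x \<le> w x \<and> w x \<le> b x div 2 ^ (s x - n x))"
      unfolding defs by (intro comp_rules comp_pred_eq_leftmost)
    show "P m v \<longleftrightarrow> (\<exists>z. (\<lambda>x. n x \<le> s x \<and> a x = leftmost (n x) \<and> b x = leftmost (s x) \<and>
        a x \<le> w x \<and> w x \<le> b x div 2 ^ (s x - n x)) (prod_encode (prod_encode (m, v), z)))" for m v
    proof -
      have "P m v \<longleftrightarrow> (\<exists>t\<ge>m. leftmost m \<le> v \<and> v \<le> leftmost t div 2 ^ (t - m))"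
        unfolding P_def ce_iff by blast
      then show ?thesis
        unfolding defs by (auto intro: exI[of _ "prod_encode (t, prod_encode (leftmost m, leftmost t))" for t])
    qed
  qed
  moreover have "turing_functional ?\<Psi>"
  proof (rule turing_functional_zero)
    show "comp_pred (\<lambda>x. n x \<le> s x \<and> a x = leftmost (n x) \<and> b x = leftmost (s x) \<and>
        w x + a x \<le> b x div 2 ^ (s x - n x))"
      unfolding defs by (intro comp_rules comp_pred_eq_leftmost)
    show "Q m v \<longleftrightarrow> (\<exists>z. (\<lambda>x. n x \<le> s x \<and> a x = leftmost (n x) \<and> b x = leftmost (s x) \<and>
        w x + a x \<le> b x div 2 ^ (s x - n x)) (prod_encode (prod_encode (m, v), z)))" for m v
    proof -
      have "Q m v \<longleftrightarrow> (\<exists>t\<ge>m. v + leftmost m \<le> leftmost t div 2 ^ (t - m))"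
        unfolding Q_def ce_iff by blast
      then show ?thesis
        unfolding defs by (auto intro: exI[of _ "prod_encode (t, prod_encode (leftmost m, leftmost t))" for t])
    qed
  qed
  moreover have "induced_sm ?\<Phi> = induced_sm ?\<Psi>"
  proof
    fix \<sigma>
    \<comment> \<open>Both sets are intervals with \<open>seqval X m - leftmost m + 1\<close>
      elements, all below \<open>2 ^ m\<close>.\<close>
    have "card {v. v < 2 ^ m \<and> P m v} = card {v. v < 2 ^ m \<and> Q m v}" for m
    proof -
      have "{v. v < 2 ^ m \<and> P m v} = {leftmost m..seqval X m}"
           "{v. v < 2 ^ m \<and> Q m v} = {..seqval X m - leftmost m}"
        using seqval_less[of X m] le[of m] by (auto simp: P_def Q_def)
      then show ?thesis using le[of m] by simp
    qed
    then show "induced_sm ?\<Phi> \<sigma> = induced_sm ?\<Psi> \<sigma>"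
      using induced_sm_zero[OF P_nested P0] induced_sm_zero[OF Q_nested Q0] by simp
  qed
  moreover have "X \<in> MLR \<inter> tf_dom ?\<Phi>"
    using leftmost_limit_MLR[OF lim] le by (auto simp: tf_dom_zero[OF P_nested P0] P_def)
  moreover have "Y \<notin> MLR" if Y: "Y \<in> tf_dom ?\<Psi>" for Y
  proof -
    \<comment> \<open>A true bit at \<open>k\<close> gives
      \<open>seqval Y m \<ge> 2 ^ (m - Suc k)\<close>, while all elements of the shifted interval
      are smaller once the prefix of length \<open>Suc k\<close> has settled at stage
      \<open>m\<close>.\<close>
    have "\<not> Y k" for k
    proof
      assume "Y k"
      define j where "j = Suc k"
      obtain m where m: "j \<le> m" "leftmost m div 2 ^ (m - j) = seqval X j" using lim_ge by blast
      let ?d = "2 ^ (m - j) :: nat"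
      have "Q m (seqval Y m)" using Y by (simp add: tf_dom_zero[OF Q_nested Q0])
      then have "seqval Y m + leftmost m \<le> seqval X m" by (simp add: Q_def)
      moreover have "leftmost m div ?d = seqval X m div ?d" using m seqval_div[of j m X] by simp
      then have "seqval X m < leftmost m + ?d"
        by (intro less_add_if_div_eq) simp_all
      moreover have "?d \<le> seqval Y m"
      proof -
        have "seqval Y m div ?d = seqval Y j" using seqval_div m by blast
        also have "\<dots> \<noteq> 0" using \<open>Y k\<close> by (simp add: j_def seqval_Suc)
        finally show ?thesis by (metis div_less not_less)
      qed
      ultimately show False by simp
    qed
    then have "Y = (\<lambda>_. False)" by auto
    then show ?thesis using zero_seq_not_MLR by simp
  qed
  then have "tf_image ?\<Psi> MLR = {}" by (auto simp: tf_image_def)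
  ultimately show ?thesis
    by (intro exI[of _ ?\<Phi>] exI[of _ ?\<Psi>]) (auto simp: tf_image_def)
qed

end
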